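(* Let $\mathrm{AS}=\mathrm{S}\oplus\mathrm{S}^-$ be a $\mathbf{Z}/2\mathbf{Z}$-graded ring. For an $\mathrm{AS}$-module $M$, let $\theta_M:\mathrm{S}^-\otimes_{\mathrm{S}}M\to M$ be the $\mathrm{S}$-module homomorphism induced by the action of $\mathrm{S}^-\subset\mathrm{AS}$ on $M$. Then $M\mapsto(M,\theta_M)$ is an isomorphism of categories from the category of $\mathrm{AS}$-modules to the category $(\mathrm{S},\phi)\text{-}\mathrm{Mod}$.
   Context: Rings are unital and modules are left modules. A $\mathbf{Z}/2\mathbf{Z}$-grading on a ring $\mathrm{AS}$ is a decomposition $\mathrm{AS}=\mathrm{S}\oplus\mathrm{S}^-$ into additive subgroups such that $\mathrm{S}$ is a (unital) subring, $\mathrm{S}^-$ is closed under left and right multiplication by $\mathrm{S}$, and $\alpha\beta\in\mathrm{S}$ for all $\alpha,\beta\in\mathrm{S}^-$. Then $\mathrm{S}^-$ is an $(\mathrm{S},\mathrm{S})$-bimodule and multiplication induces an $(\mathrm{S},\mathrm{S})$-bimodule homomorphism $\phi:\mathrm{S}^-\otimes_{\mathrm{S}}\mathrm{S}^-\to\mathrm{S}$, $\alpha\otimes\beta\mapsto\alpha\beta$. For an $\mathrm{S}$-module $N$ put $D(N)=\mathrm{S}^-\otimes_{\mathrm{S}}N$, and $D(f)=\mathrm{id}_{\mathrm{S}^-}\otimes f$ for an $\mathrm{S}$-module homomorphism $f$. An $\mathrm{S}$-module homomorphism $\theta:D(N)\to N$ is compatible with $\phi$ if $\theta\circ D(\theta)=\phi\otimes\mathrm{id}_N$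 as maps $D^2(N)=\mathrm{S}^-\otimes_{\mathrm{S}}\mathrm{S}^-\otimes_{\mathrm{S}}N\to\mathrm{S}\otimes_{\mathrm{S}}N=N$. The category $(\mathrm{S},\phi)\text{-}\mathrm{Mod}$ has as objects pairs $(N,\theta)$ with $N$ an $\mathrm{S}$-module and $\theta:D(N)\to N$ an $\mathrm{S}$-homomorphism compatible with $\phi$; a morphism $(N,\theta)\to(N',\theta')$ is an $\mathrm{S}$-module homomorphism $f:N\to N'$ with $f\circ\theta=\theta'\circ D(f)$. *)

theory Defs
  imports "HOL-Algebra.Free_Abelian_Groups" "HOL-Algebra.Module" "HOL-Algebra.Subrings"
begin

section \<open>Categories\<close>

text \<open>Morphisms are families of hom-sets: the same \<open>f :: 'h\<close> may belong to several hom-sets, so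
  composition and identities carry the objects as arguments; \<open>cat_comp C X Y Z g f\<close> is \<open>g\<close> after
  \<open>f\<close> for \<open>f : X \<rightarrow> Y\<close> and \<open>g : Y \<rightarrow> Z\<close>.\<close>

record ('o, 'h) category =
  cat_obj :: "'o set"
  cat_hom :: "'o \<Rightarrow> 'o \<Rightarrow> 'h set"
  cat_id :: "'o \<Rightarrow> 'h"
  cat_comp :: "'o \<Rightarrow> 'o \<Rightarrow> 'o \<Rightarrow> 'h \<Rightarrow> 'h \<Rightarrow> 'h"

definition is_category :: "('o, 'h) category \<Rightarrow> bool" where
  "is_category C \<longleftrightarrow>
     (\<forall>X\<in>cat_obj C. cat_id C X \<in> cat_hom C X X) \<and>
     (\<forall>X\<in>cat_obj C. \<forall>Y\<in>cat_obj C. \<forall>Z\<in>cat_obj C. \<forall>f\<in>cat_hom C X Y. \<forall>g\<in>cat_hom C Y Z.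
        cat_comp C X Y Z g f \<in> cat_hom C X Z) \<and>
     (\<forall>X\<in>cat_obj C. \<forall>Y\<in>cat_obj C. \<forall>f\<in>cat_hom C X Y.
        cat_comp C X X Y f (cat_id C X) = f \<and> cat_comp C X Y Y (cat_id C Y) f = f) \<and>
     (\<forall>W\<in>cat_obj C. \<forall>X\<in>cat_obj C. \<forall>Y\<in>cat_obj C. \<forall>Z\<in>cat_obj C.
        \<forall>f\<in>cat_hom C W X. \<forall>g\<in>cat_hom C X Y. \<forall>h\<in>cat_hom C Y Z.
        cat_comp C W Y Z h (cat_comp C W X Y g f) = cat_comp C W X Z (cat_comp C X Y Z h g) f)"

definition is_functor ::
  "('o, 'h) category \<Rightarrow> ('p, 'k) category \<Rightarrow> ('o \<Rightarrow> 'p) \<Rightarrow> ('o \<Rightarrow> 'o \<Rightarrow> 'h \<Rightarrow> 'k) \<Rightarrow> bool" where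
  "is_functor C D F Fm \<longleftrightarrow>
     (\<forall>X\<in>cat_obj C. F X \<in> cat_obj D) \<and>
     (\<forall>X\<in>cat_obj C. \<forall>Y\<in>cat_obj C. \<forall>f\<in>cat_hom C X Y. Fm X Y f \<in> cat_hom D (F X) (F Y)) \<and>
     (\<forall>X\<in>cat_obj C. Fm X X (cat_id C X) = cat_id D (F X)) \<and>
     (\<forall>X\<in>cat_obj C. \<forall>Y\<in>cat_obj C. \<forall>Z\<in>cat_obj C. \<forall>f\<in>cat_hom C X Y. \<forall>g\<in>cat_hom C Y Z.
        Fm X Z (cat_comp C X Y Z g f) = cat_comp D (F X) (F Y) (F Z) (Fm Y Z g) (Fm X Y f))"

definition category_isomorphism ::
  "('o, 'h) category \<Rightarrow> ('p, 'k) category \<Rightarrow> ('o \<Rightarrow> 'p) \<Rightarrow> ('o \<Rightarrow> 'o \<Rightarrow> 'h \<Rightarrow> 'k) \<Rightarrow> bool" where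
  "category_isomorphism C D F Fm \<longleftrightarrow>
     is_category C \<and> is_category D \<and> is_functor C D F Fm \<and>
     (\<exists>G Gm. is_functor D C G Gm \<and>
        (\<forall>X\<in>cat_obj C. G (F X) = X) \<and>
        (\<forall>X\<in>cat_obj C. \<forall>Y\<in>cat_obj C. \<forall>f\<in>cat_hom C X Y. Gm (F X) (F Y) (Fm X Y f) = f) \<and>
        (\<forall>X\<in>cat_obj D. F (G X) = X) \<and>
        (\<forall>X\<in>cat_obj D. \<forall>Y\<in>cat_obj D. \<forall>f\<in>cat_hom D X Y. Fm (G X) (G Y) (Gm X Y f) = f))"


section \<open>Left modules over a noncommutative ring\<close>

text \<open>The locale \<^locale>\<open>module\<close> requires a commutative base ring; only its record type is reused.\<close>

locale left_module = R?: ring R + M?: abelian_group M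
  for R :: "('a, 'r) ring_scheme" (structure) and M :: "('a, 'm, 'z) module_scheme" (structure) +
  assumes smult_closed: "\<lbrakk>a \<in> carrier R; x \<in> carrier M\<rbrakk> \<Longrightarrow> a \<odot>\<^bsub>M\<^esub> x \<in> carrier M"
    and smult_l_distr: "\<lbrakk>a \<in> carrier R; b \<in> carrier R; x \<in> carrier M\<rbrakk>
      \<Longrightarrow> (a \<oplus>\<^bsub>R\<^esub> b) \<odot>\<^bsub>M\<^esub> x = a \<odot>\<^bsub>M\<^esub> x \<oplus>\<^bsub>M\<^esub> b \<odot>\<^bsub>M\<^esub> x"
    and smult_r_distr: "\<lbrakk>a \<in> carrier R; x \<in> carrier M; y \<in> carrier M\<rbrakk>
      \<Longrightarrow> a \<odot>\<^bsub>M\<^esub> (x \<oplus>\<^bsub>M\<^esub> y) = a \<odot>\<^bsub>M\<^esub> x \<oplus>\<^bsub>M\<^esub> a \<odot>\<^bsub>M\<^esub> y"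
    and smult_assoc: "\<lbrakk>a \<in> carrier R; b \<in> carrier R; x \<in> carrier M\<rbrakk>
      \<Longrightarrow> (a \<otimes>\<^bsub>R\<^esub> b) \<odot>\<^bsub>M\<^esub> x = a \<odot>\<^bsub>M\<^esub> (b \<odot>\<^bsub>M\<^esub> x)"
    and smult_one: "x \<in> carrier M \<Longrightarrow> \<one>\<^bsub>R\<^esub> \<odot>\<^bsub>M\<^esub> x = x"

text \<open>A module is the data of a carrier, a zero, an addition and a scalar multiplication. The record
  type has further content: the unused ring fields \<open>mult\<close> and \<open>one\<close>, and the values of
  the operations off the carriers. Pinning these down makes equality of records coincide with
  equality of modules, which matters for isomorphisms (rather than equivalences) of categories.\<close>

definition normal_module :: "('a, 'r) ring_scheme \<Rightarrow> ('a, 'm) module \<Rightarrow> bool" where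
  "normal_module R M \<longleftrightarrow> left_module R M \<and>
     mult M = undefined \<and> one M = undefined \<and>
     add M \<in> extensional (carrier M) \<and>
     (\<forall>x\<in>carrier M. add M x \<in> extensional (carrier M)) \<and>
     smult M \<in> extensional (carrier R) \<and>
     (\<forall>a\<in>carrier R. smult M a \<in> extensional (carrier M))"

definition module_homs ::
  "('a, 'r) ring_scheme \<Rightarrow> ('a, 'm, 'y) module_scheme \<Rightarrow> ('a, 'n, 'z) module_scheme \<Rightarrow> ('m \<Rightarrow> 'n) set"
  where
  "module_homs R M N = {f \<in> carrier M \<rightarrow>\<^sub>E carrier N.
     (\<forall>x\<in>carrier M. \<forall>y\<in>carrier M. f (x \<oplus>\<^bsub>M\<^esub> y) = f x \<oplus>\<^bsub>N\<^esub> f y) \<and>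
     (\<forall>a\<in>carrier R. \<forall>x\<in>carrier M. f (a \<odot>\<^bsub>M\<^esub> x) = a \<odot>\<^bsub>N\<^esub> f x)}"

text \<open>The category of left modules whose underlying set is a subset of \<open>'m\<close>.\<close>

definition module_category ::
  "('a, 'r) ring_scheme \<Rightarrow> (('a, 'm) module, 'm \<Rightarrow> 'm) category" where
  "module_category R =
     \<lparr>cat_obj = {M. normal_module R M},
      cat_hom = module_homs R,
      cat_id = (\<lambda>M. \<lambda>x\<in>carrier M. x),
      cat_comp = (\<lambda>L M N g f. compose (carrier L) g f)\<rparr>"

definition restrict_scalars :: "'a set \<Rightarrow> ('a, 'm) module \<Rightarrow> ('a, 'm) module" where
  "restrict_scalars S M = M\<lparr>smult := restrict (smult M) S\<rparr>"


section \<open>Tensor products over a noncommutative ring\<close>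

record ('a, 'm) bimodule = "('a, 'm) module" +
  rsmult :: "'m \<Rightarrow> 'a \<Rightarrow> 'm"

text \<open>An additive subgroup \<open>X\<close> of a ring with the operations of the ring: the ring itself
  and the odd part of a graded ring are bimodules in this way.\<close>

definition mult_bimodule :: "('a, 'r) ring_scheme \<Rightarrow> 'a set \<Rightarrow> ('a, 'a) bimodule" where
  "mult_bimodule A X = \<lparr>carrier = X, mult = mult A, one = one A, zero = zero A, add = add A,
     smult = mult A, rsmult = mult A\<rparr>"

text \<open>The tensor product of a right module \<open>A\<close> and a left module \<open>N\<close> is the free abelian group on
  \<open>A \<times> N\<close> modulo the balanced bilinear relations. The left scalar multiplication of \<open>A\<close> is
  used only to make the tensor product a left module.\<close>

definition tensor_relations ::
  "('a, 'r) ring_scheme \<Rightarrow> ('a, 'm, 'y) bimodule_scheme \<Rightarrow> ('a, 'n, 'z) module_scheme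
    \<Rightarrow> ('m \<times> 'n \<Rightarrow>\<^sub>0 int) set" where
  "tensor_relations R A N =
     {frag_of (a \<oplus>\<^bsub>A\<^esub> b, x) - frag_of (a, x) - frag_of (b, x) | a b x.
        a \<in> carrier A \<and> b \<in> carrier A \<and> x \<in> carrier N} \<union>
     {frag_of (a, x \<oplus>\<^bsub>N\<^esub> y) - frag_of (a, x) - frag_of (a, y) | a x y.
        a \<in> carrier A \<and> x \<in> carrier N \<and> y \<in> carrier N} \<union>
     {frag_of (rsmult A a r, x) - frag_of (a, r \<odot>\<^bsub>N\<^esub> x) | a r x.
        a \<in> carrier A \<and> r \<in> carrier R \<and> x \<in> carrier N}"

definition tensor_kernel ::
  "('a, 'r) ring_scheme \<Rightarrow> ('a, 'm, 'y) bimodule_scheme \<Rightarrow> ('a, 'n, 'z) module_scheme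
    \<Rightarrow> ('m \<times> 'n \<Rightarrow>\<^sub>0 int) set" where
  "tensor_kernel R A N =
     generate (free_Abelian_group (carrier A \<times> carrier N)) (tensor_relations R A N)"

definition tensor_group ::
  "('a, 'r) ring_scheme \<Rightarrow> ('a, 'm, 'y) bimodule_scheme \<Rightarrow> ('a, 'n, 'z) module_scheme
    \<Rightarrow> ('m \<times> 'n \<Rightarrow>\<^sub>0 int) set monoid" where
  "tensor_group R A N = free_Abelian_group (carrier A \<times> carrier N) Mod tensor_kernel R A N"

definition pure_tensor ::
  "('a, 'r) ring_scheme \<Rightarrow> ('a, 'm, 'y) bimodule_scheme \<Rightarrow> ('a, 'n, 'z) module_scheme
    \<Rightarrow> 'm \<Rightarrow> 'n \<Rightarrow> ('m \<times> 'n \<Rightarrow>\<^sub>0 int) set" where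
  "pure_tensor R A N a x =
     tensor_kernel R A N #>\<^bsub>free_Abelian_group (carrier A \<times> carrier N)\<^esub> frag_of (a, x)"

text \<open>The homomorphism on the tensor product induced by a balanced map \<open>b\<close> into the abelian group
  \<open>P\<close>, written multiplicatively; \<open>tensor_lift_unique\<close> below shows that it is well defined.\<close>

definition tensor_lift ::
  "('a, 'r) ring_scheme \<Rightarrow> ('a, 'm, 'y) bimodule_scheme \<Rightarrow> ('a, 'n, 'z) module_scheme
    \<Rightarrow> ('p, 'w) monoid_scheme \<Rightarrow> ('m \<Rightarrow> 'n \<Rightarrow> 'p) \<Rightarrow> ('m \<times> 'n \<Rightarrow>\<^sub>0 int) set \<Rightarrow> 'p" where
  "tensor_lift R A N P b = (THE f.
     f \<in> hom (tensor_group R A N) P \<and> f \<in> extensional (carrier (tensor_group R A N)) \<and>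
     (\<forall>a\<in>carrier A. \<forall>x\<in>carrier N. f (pure_tensor R A N a x) = b a x))"

definition balanced ::
  "('a, 'r) ring_scheme \<Rightarrow> ('a, 'm, 'y) bimodule_scheme \<Rightarrow> ('a, 'n, 'z) module_scheme
    \<Rightarrow> ('p, 'w) monoid_scheme \<Rightarrow> ('m \<Rightarrow> 'n \<Rightarrow> 'p) \<Rightarrow> bool" where
  "balanced R A N P b \<longleftrightarrow>
     (\<forall>a\<in>carrier A. \<forall>x\<in>carrier N. b a x \<in> carrier P) \<and>
     (\<forall>a\<in>carrier A. \<forall>a'\<in>carrier A. \<forall>x\<in>carrier N. b (a \<oplus>\<^bsub>A\<^esub> a') x = b a x \<otimes>\<^bsub>P\<^esub> b a' x) \<and>
     (\<forall>a\<in>carrier A. \<forall>x\<in>carrier N. \<forall>y\<in>carrier N. b a (x \<oplus>\<^bsub>N\<^esub> y) = b a x \<otimes>\<^bsub>P\<^esub> b a y) \<and>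
     (\<forall>a\<in>carrier A. \<forall>r\<in>carrier R. \<forall>x\<in>carrier N. b (rsmult A a r) x = b a (r \<odot>\<^bsub>N\<^esub> x))"

definition closed_ops ::
  "('a, 'r) ring_scheme \<Rightarrow> ('a, 'm, 'y) bimodule_scheme \<Rightarrow> ('a, 'n, 'z) module_scheme \<Rightarrow> bool" where
  "closed_ops R A N \<longleftrightarrow>
     (\<forall>a\<in>carrier A. \<forall>a'\<in>carrier A. a \<oplus>\<^bsub>A\<^esub> a' \<in> carrier A) \<and>
     (\<forall>x\<in>carrier N. \<forall>y\<in>carrier N. x \<oplus>\<^bsub>N\<^esub> y \<in> carrier N) \<and>
     (\<forall>a\<in>carrier A. \<forall>r\<in>carrier R. rsmult A a r \<in> carrier A) \<and>
     (\<forall>r\<in>carrier R. \<forall>x\<in>carrier N. r \<odot>\<^bsub>N\<^esub> x \<in> carrier N)"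

lemma free_diff_closed: "x \<in> carrier (free_Abelian_group T) \<Longrightarrow> y \<in> carrier (free_Abelian_group T) \<Longrightarrow> x - y \<in> carrier (free_Abelian_group T)"
  using keys_diff[of x y] by auto

lemma tensor_relations_closed:
  assumes "closed_ops R A N"
  shows "tensor_relations R A N \<subseteq> carrier (free_Abelian_group (carrier A \<times> carrier N))"
  using assms unfolding tensor_relations_def closed_ops_def
  by (auto intro!: free_diff_closed simp del: carrier_free_Abelian_group_iff diff_diff_add diff_diff_eq)

lemma tensor_kernel_normal:
  assumes "closed_ops R A N"
  shows "tensor_kernel R A N \<lhd> free_Abelian_group (carrier A \<times> carrier N)"
  unfolding tensor_kernel_def
  using comm_group.normal_iff_subgroup[OF abelian_free_Abelian_group] group.generate_is_subgroup[OF group_free_Abelian_group tensor_relations_closed[OF assms]] by blast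

lemma tensor_group_comm:
  assumes "closed_ops R A N" shows "comm_group (tensor_group R A N)"
  unfolding tensor_group_def
  using comm_group.abelian_FactGroup[OF abelian_free_Abelian_group] normal_imp_subgroup[OF tensor_kernel_normal[OF assms]] by blast

lemma pure_tensor_closed: "closed_ops R A N \<Longrightarrow> a \<in> carrier A \<Longrightarrow> x \<in> carrier N \<Longrightarrow> pure_tensor R A N a x \<in> carrier (tensor_group R A N)"
  unfolding tensor_group_def pure_tensor_def carrier_FactGroup by auto

lemma tensor_quotient_hom:
  assumes c: "closed_ops R A N"
  shows "group_hom (free_Abelian_group (carrier A \<times> carrier N)) (tensor_group R A N)
    (\<lambda>z. tensor_kernel R A N #>\<^bsub>free_Abelian_group (carrier A \<times> carrier N)\<^esub> z)"
proof -
  interpret n: normal "tensor_kernel R A N" "free_Abelian_group (carrier A \<times> carrier N)" by (rule tensor_kernel_normal[OF c])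
  interpret T: comm_group "tensor_group R A N" by (rule tensor_group_comm[OF c])
  show ?thesis using n.r_coset_hom_Mod T.is_group
    by (simp add: group_hom_def group_hom_axioms_def tensor_group_def)
qed

lemma tensor_induct [consumes 2, case_names one pure mult inv]:
  assumes c: "closed_ops R A N" and t: "t \<in> carrier (tensor_group R A N)"
    and one: "Q \<one>\<^bsub>tensor_group R A N\<^esub>"
    and pure: "\<And>a x. a \<in> carrier A \<Longrightarrow> x \<in> carrier N \<Longrightarrow> Q (pure_tensor R A N a x)"
    and mul: "\<And>s t. s \<in> carrier (tensor_group R A N) \<Longrightarrow> t \<in> carrier (tensor_group R A N) \<Longrightarrow> Q s \<Longrightarrow> Q t \<Longrightarrow> Q (s \<otimes>\<^bsub>tensor_group R A N\<^esub> t)"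
    and inv: "\<And>s. s \<in> carrier (tensor_group R A N) \<Longrightarrow> Q s \<Longrightarrow> Q (inv\<^bsub>tensor_group R A N\<^esub> s)"
  shows "Q t"
proof -
  let ?F = "free_Abelian_group (carrier A \<times> carrier N)"
  let ?q = "\<lambda>z. tensor_kernel R A N #>\<^bsub>?F\<^esub> z"
  interpret q: group_hom ?F "tensor_group R A N" ?q by (rule tensor_quotient_hom[OF c])
  obtain z where z: "z \<in> carrier ?F" "t = ?q z" using t unfolding tensor_group_def carrier_FactGroup by auto
  have "Q (?q z)"
  proof (rule free_Abelian_group_induct[where x = z and P = "\<lambda>z. Q (?q z)"])
    show "Poly_Mapping.keys z \<subseteq> carrier A \<times> carrier N" using z by simp
    show "Q (?q 0)" using one q.hom_one by (simp only: one_free_Abelian_group)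
    show "Q (?q (frag_of u))" if "u \<in> carrier A \<times> carrier N" for u
      using pure that unfolding pure_tensor_def by (cases u) auto
    fix u v assume k: "Poly_Mapping.keys u \<subseteq> carrier A \<times> carrier N" "Poly_Mapping.keys v \<subseteq> carrier A \<times> carrier N"
      and Q: "Q (?q u)" "Q (?q v)"
    have m: "u \<in> carrier ?F" "v \<in> carrier ?F" using k by auto
    have e: "u - v = u \<otimes>\<^bsub>?F\<^esub> inv\<^bsub>?F\<^esub> v" using k by simp
    have "?q (u - v) = ?q u \<otimes>\<^bsub>tensor_group R A N\<^esub> inv\<^bsub>tensor_group R A N\<^esub> ?q v"
      unfolding e using m q.hom_mult[of u "inv\<^bsub>?F\<^esub> v"] q.hom_inv[of v] group.inv_closed[OF group_free_Abelian_group, of v] by metis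
    moreover have "inv\<^bsub>tensor_group R A N\<^esub> ?q v \<in> carrier (tensor_group R A N)"
      using group.inv_closed comm_group.axioms(2)[OF tensor_group_comm[OF c]] q.hom_closed[OF m(2)] by blast
    ultimately show "Q (?q (u - v))" using mul inv Q q.hom_closed[OF m(1)] q.hom_closed[OF m(2)] by metis
  qed
  then show ?thesis using z by simp
qed

lemma tensor_lift_unique:
  assumes c: "closed_ops R A N" and P: "comm_group P" and b: "balanced R A N P b"
  shows "\<exists>!f. f \<in> hom (tensor_group R A N) P \<and> f \<in> extensional (carrier (tensor_group R A N)) \<and>
     (\<forall>a\<in>carrier A. \<forall>x\<in>carrier N. f (pure_tensor R A N a x) = b a x)"
proof (rule ex_ex1I)
  let ?F = "free_Abelian_group (carrier A \<times> carrier N)"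
  let ?T = "tensor_group R A N"
  let ?q = "\<lambda>z. tensor_kernel R A N #>\<^bsub>?F\<^esub> z"
  interpret q: group_hom ?F ?T ?q by (rule tensor_quotient_hom[OF c])
  interpret P: comm_group P by (rule P)
  have Tg: "Group.group ?T" using tensor_group_comm[OF c] by (rule comm_group.axioms(2))
  have im: "case_prod b ` (carrier A \<times> carrier N) \<subseteq> carrier P" using b unfolding balanced_def by auto
  obtain h where h: "h \<in> hom ?F P" and hb: "\<And>z. z \<in> carrier A \<times> carrier N \<Longrightarrow> h (frag_of z) = case_prod b z"
    using P.free_Abelian_group_universal[OF im] by metis
  interpret h: group_hom ?F P h using h P.is_group by (simp add: group_hom_def group_hom_axioms_def)
  have hd: "h (u - v) = h u \<otimes>\<^bsub>P\<^esub> inv\<^bsub>P\<^esub> h v" if "u \<in> carrier ?F" "v \<in> carrier ?F" for u v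
  proof -
    have "u - v = u \<otimes>\<^bsub>?F\<^esub> inv\<^bsub>?F\<^esub> v" using that by simp
    then show ?thesis using that h.hom_mult[of u "inv\<^bsub>?F\<^esub> v"] h.hom_inv[of v] group.inv_closed[OF group_free_Abelian_group, of v] by metis
  qed
  have fr: "frag_of (a,x) \<in> carrier ?F" if "a \<in> carrier A" "x \<in> carrier N" for a x using that by simp
  have pc: "u \<otimes>\<^bsub>P\<^esub> v \<otimes>\<^bsub>P\<^esub> inv\<^bsub>P\<^esub> u \<otimes>\<^bsub>P\<^esub> inv\<^bsub>P\<^esub> v = \<one>\<^bsub>P\<^esub>" if "u \<in> carrier P" "v \<in> carrier P" for u v
    using that by (metis P.inv_closed P.inv_solve_right P.m_closed P.m_comm P.m_assoc P.r_inv P.l_one P.one_closed)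
  have h3: "h (frag_of p - frag_of r - frag_of s) = case_prod b p \<otimes>\<^bsub>P\<^esub> inv\<^bsub>P\<^esub> case_prod b r \<otimes>\<^bsub>P\<^esub> inv\<^bsub>P\<^esub> case_prod b s"
    and h2: "h (frag_of p - frag_of r) = case_prod b p \<otimes>\<^bsub>P\<^esub> inv\<^bsub>P\<^esub> case_prod b r"
    if "p \<in> carrier A \<times> carrier N" "r \<in> carrier A \<times> carrier N" "s \<in> carrier A \<times> carrier N" for p r s
  proof -
    have i: "frag_of p \<in> carrier ?F" "frag_of r \<in> carrier ?F" "frag_of s \<in> carrier ?F" using that by simp_all
    show "h (frag_of p - frag_of r) = case_prod b p \<otimes>\<^bsub>P\<^esub> inv\<^bsub>P\<^esub> case_prod b r" using hd[OF i(1,2)] hb that by metis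
    then show "h (frag_of p - frag_of r - frag_of s) = case_prod b p \<otimes>\<^bsub>P\<^esub> inv\<^bsub>P\<^esub> case_prod b r \<otimes>\<^bsub>P\<^esub> inv\<^bsub>P\<^esub> case_prod b s"
      using hd[OF free_diff_closed[OF i(1,2)] i(3)] hb that by metis
  qed
  have "tensor_relations R A N \<subseteq> kernel ?F P h"
  proof
    fix z assume z: "z \<in> tensor_relations R A N"
    then have zF: "z \<in> carrier ?F" using tensor_relations_closed[OF c] by blast
    have bc: "\<And>a x. a \<in> carrier A \<Longrightarrow> x \<in> carrier N \<Longrightarrow> b a x \<in> carrier P" using b by (simp add: balanced_def)
    have "h z = \<one>\<^bsub>P\<^esub>" using z unfolding tensor_relations_def
    proof (elim UnE CollectE exE conjE)
      fix a a' x assume "z = frag_of (a \<oplus>\<^bsub>A\<^esub> a', x) - frag_of (a, x) - frag_of (a', x)" and m: "a \<in> carrier A" "a' \<in> carrier A" "x \<in> carrier N"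
      moreover have "a \<oplus>\<^bsub>A\<^esub> a' \<in> carrier A" using m c by (simp add: closed_ops_def)
      ultimately have "h z = b (a \<oplus>\<^bsub>A\<^esub> a') x \<otimes>\<^bsub>P\<^esub> inv\<^bsub>P\<^esub> b a x \<otimes>\<^bsub>P\<^esub> inv\<^bsub>P\<^esub> b a' x"
        using h3 by (simp del: diff_diff_add diff_diff_eq)
      also have "\<dots> = \<one>\<^bsub>P\<^esub>" using m b bc[OF m(1,3)] bc[OF m(2,3)] unfolding balanced_def
        by (simp add: pc)
      finally show ?thesis .
    next
      fix a x y assume "z = frag_of (a, x \<oplus>\<^bsub>N\<^esub> y) - frag_of (a, x) - frag_of (a, y)" and m: "a \<in> carrier A" "x \<in> carrier N" "y \<in> carrier N"
      moreover have "x \<oplus>\<^bsub>N\<^esub> y \<in> carrier N" using m c by (simp add: closed_ops_def)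
      ultimately have "h z = b a (x \<oplus>\<^bsub>N\<^esub> y) \<otimes>\<^bsub>P\<^esub> inv\<^bsub>P\<^esub> b a x \<otimes>\<^bsub>P\<^esub> inv\<^bsub>P\<^esub> b a y"
        using h3 by (simp del: diff_diff_add diff_diff_eq)
      also have "\<dots> = \<one>\<^bsub>P\<^esub>" using m b bc[OF m(1,3)] bc[OF m(1,2)] unfolding balanced_def
        by (simp add: pc)
      finally show ?thesis .
    next
      fix a r x assume "z = frag_of (rsmult A a r, x) - frag_of (a, r \<odot>\<^bsub>N\<^esub> x)" and m: "a \<in> carrier A" "r \<in> carrier R" "x \<in> carrier N"
      moreover have "rsmult A a r \<in> carrier A" "r \<odot>\<^bsub>N\<^esub> x \<in> carrier N" using m c by (simp_all add: closed_ops_def)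
      ultimately show ?thesis using h2[of "(rsmult A a r, x)" "(a, r \<odot>\<^bsub>N\<^esub> x)" "(a, x)"] b bc unfolding balanced_def by simp
    qed
    then show "z \<in> kernel ?F P h" using zF by (simp add: kernel_def)
  qed
  then have "tensor_kernel R A N \<subseteq> kernel ?F P h" unfolding tensor_kernel_def
    using h.subgroup_kernel group.generate_subgroup_incl[OF group_free_Abelian_group] by blast
  then obtain g where g: "g \<in> hom ?T P" "\<And>z. z \<in> carrier ?F \<Longrightarrow> g (?q z) = h z"
    using h.FactGroup_universal_kernel[OF tensor_kernel_normal[OF c]] unfolding tensor_group_def by metis
  let ?g = "restrict g (carrier ?T)"
  show "\<exists>f. f \<in> hom ?T P \<and> f \<in> extensional (carrier ?T) \<and> (\<forall>a\<in>carrier A. \<forall>x\<in>carrier N. f (pure_tensor R A N a x) = b a x)"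
  proof (intro exI conjI ballI)
    show "?g \<in> hom ?T P" using g(1) monoid.m_closed[OF group.is_monoid[OF Tg]] by (auto simp: hom_def)
    show "?g \<in> extensional (carrier ?T)" by simp
    fix a x assume m: "a \<in> carrier A" "x \<in> carrier N"
    show "?g (pure_tensor R A N a x) = b a x"
      using pure_tensor_closed[OF c m] g(2)[OF fr[OF m]] hb m by (simp add: pure_tensor_def)
  qed
  fix f f'
  assume f: "f \<in> hom ?T P \<and> f \<in> extensional (carrier ?T) \<and> (\<forall>a\<in>carrier A. \<forall>x\<in>carrier N. f (pure_tensor R A N a x) = b a x)"
    and f': "f' \<in> hom ?T P \<and> f' \<in> extensional (carrier ?T) \<and> (\<forall>a\<in>carrier A. \<forall>x\<in>carrier N. f' (pure_tensor R A N a x) = b a x)"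
  interpret f: group_hom ?T P f using f P.is_group Tg by (simp add: group_hom_def group_hom_axioms_def)
  interpret f': group_hom ?T P f' using f' P.is_group Tg by (simp add: group_hom_def group_hom_axioms_def)
  have "f t = f' t" if "t \<in> carrier ?T" for t
    using c that by (induction t rule: tensor_induct) (use f f' in auto)
  then show "f = f'" using f f' by (meson extensionalityI)
qed

definition tensor_map ::
  "('a, 'r) ring_scheme \<Rightarrow> ('a, 'm, 'y) bimodule_scheme \<Rightarrow> ('a, 'n, 'z) module_scheme
    \<Rightarrow> ('a, 'p, 'v) bimodule_scheme \<Rightarrow> ('a, 'q, 'w) module_scheme
    \<Rightarrow> ('m \<Rightarrow> 'p) \<Rightarrow> ('n \<Rightarrow> 'q) \<Rightarrow> ('m \<times> 'n \<Rightarrow>\<^sub>0 int) set \<Rightarrow> ('p \<times> 'q \<Rightarrow>\<^sub>0 int) set" where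
  "tensor_map R A N A' N' g f =
     tensor_lift R A N (tensor_group R A' N') (\<lambda>a x. pure_tensor R A' N' (g a) (f x))"

definition tensor ::
  "('a, 'r) ring_scheme \<Rightarrow> ('a, 'm, 'y) bimodule_scheme \<Rightarrow> ('a, 'n, 'z) module_scheme
    \<Rightarrow> ('a, ('m \<times> 'n \<Rightarrow>\<^sub>0 int) set) module" where
  "tensor R A N =
     \<lparr>carrier = carrier (tensor_group R A N), mult = undefined, one = undefined,
      zero = \<one>\<^bsub>tensor_group R A N\<^esub>, add = mult (tensor_group R A N),
      smult = (\<lambda>r. tensor_map R A N A N (\<lambda>a. r \<odot>\<^bsub>A\<^esub> a) (\<lambda>x. x))\<rparr>"

definition bimodule_tensor ::
  "('a, 'r) ring_scheme \<Rightarrow> ('a, 'm, 'y) bimodule_scheme \<Rightarrow> ('a, 'n, 'z) bimodule_scheme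
    \<Rightarrow> ('a, ('m \<times> 'n \<Rightarrow>\<^sub>0 int) set) bimodule" where
  "bimodule_tensor R A B = module.extend (tensor R A B)
     \<lparr>rsmult = (\<lambda>t r. tensor_map R A B A B (\<lambda>a. a) (\<lambda>b. rsmult B b r) t)\<rparr>"

text \<open>The canonical identifications \<open>A \<otimes> (B \<otimes> N) \<rightarrow> (A \<otimes> B) \<otimes> N\<close> and \<open>R \<otimes> N \<rightarrow> N\<close>.\<close>

definition tensor_assoc ::
  "('a, 'r) ring_scheme \<Rightarrow> ('a, 'm, 'y) bimodule_scheme \<Rightarrow> ('a, 'p, 'w) bimodule_scheme
    \<Rightarrow> ('a, 'n, 'z) module_scheme \<Rightarrow> ('m \<times> ('p \<times> 'n \<Rightarrow>\<^sub>0 int) set \<Rightarrow>\<^sub>0 int) set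
    \<Rightarrow> (('m \<times> 'p \<Rightarrow>\<^sub>0 int) set \<times> 'n \<Rightarrow>\<^sub>0 int) set" where
  "tensor_assoc R A B N =
     tensor_lift R A (tensor R B N) (tensor_group R (bimodule_tensor R A B) N)
       (\<lambda>a. tensor_lift R B N (tensor_group R (bimodule_tensor R A B) N)
          (\<lambda>b x. pure_tensor R (bimodule_tensor R A B) N (pure_tensor R A B a b) x))"

definition tensor_unit ::
  "('a, 'r) ring_scheme \<Rightarrow> ('a, 'n) module \<Rightarrow> ('a \<times> 'n \<Rightarrow>\<^sub>0 int) set \<Rightarrow> 'n" where
  "tensor_unit R N =
     tensor_lift R (mult_bimodule R (carrier R)) N (add_monoid N) (\<lambda>r x. r \<odot>\<^bsub>N\<^esub> x)"


section \<open>The category of pairs \<open>(N, \<theta>)\<close>\<close>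

text \<open>Here \<open>B\<close> is an \<open>(R, R)\<close>-bimodule, \<open>\<phi> : B \<otimes> B \<rightarrow> R\<close> is a bimodule homomorphism and
  \<open>D N = B \<otimes> N\<close>.\<close>

definition D_map ::
  "('a, 'r) ring_scheme \<Rightarrow> ('a, 'b, 'y) bimodule_scheme \<Rightarrow> ('a, 'm, 'v) module_scheme
    \<Rightarrow> ('a, 'n, 'w) module_scheme \<Rightarrow> ('m \<Rightarrow> 'n)
    \<Rightarrow> ('b \<times> 'm \<Rightarrow>\<^sub>0 int) set \<Rightarrow> ('b \<times> 'n \<Rightarrow>\<^sub>0 int) set" where
  "D_map R B M N f = tensor_map R B M B N (\<lambda>b. b) f"

definition compatible ::
  "('a, 'r) ring_scheme \<Rightarrow> ('a, 'b) bimodule \<Rightarrow> (('b \<times> 'b \<Rightarrow>\<^sub>0 int) set \<Rightarrow> 'a)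
    \<Rightarrow> ('a, 'm) module \<Rightarrow> (('b \<times> 'm \<Rightarrow>\<^sub>0 int) set \<Rightarrow> 'm) \<Rightarrow> bool" where
  "compatible R B \<phi> N \<theta> \<longleftrightarrow>
     (let DN = tensor R B N; DDN = tensor R B DN in
       compose (carrier DDN) \<theta> (D_map R B DN N \<theta>) =
       compose (carrier DDN) (tensor_unit R N)
         (compose (carrier DDN)
           (tensor_map R (bimodule_tensor R B B) N (mult_bimodule R (carrier R)) N \<phi> (\<lambda>x. x))
           (tensor_assoc R B B N)))"

definition phi_category ::
  "('a, 'r) ring_scheme \<Rightarrow> ('a, 'b) bimodule \<Rightarrow> (('b \<times> 'b \<Rightarrow>\<^sub>0 int) set \<Rightarrow> 'a)
    \<Rightarrow> (('a, 'm) module \<times> (('b \<times> 'm \<Rightarrow>\<^sub>0 int) set \<Rightarrow> 'm), 'm \<Rightarrow> 'm) category" where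
  "phi_category R B \<phi> =
     \<lparr>cat_obj = {(N, \<theta>). normal_module R N \<and> \<theta> \<in> module_homs R (tensor R B N) N \<and>
         compatible R B \<phi> N \<theta>},
      cat_hom = (\<lambda>(N, \<theta>) (N', \<theta>'). {f \<in> module_homs R N N'.
         compose (carrier (tensor R B N)) f \<theta> =
         compose (carrier (tensor R B N)) \<theta>' (D_map R B N N' f)}),
      cat_id = (\<lambda>(N, \<theta>). \<lambda>x\<in>carrier N. x),
      cat_comp = (\<lambda>(L, \<eta>) (M, \<zeta>) (N, \<theta>) g f. compose (carrier L) g f)\<rparr>"


section \<open>Graded rings\<close>

locale z2_graded_ring = ring A for A :: "('a, 'r) ring_scheme" (structure) +
  fixes S :: "'a set" and Sm :: "'a set"
  assumes even_subring: "subring S A"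
    and odd_subgroup: "additive_subgroup Sm A"
    and decomposition: "S <+>\<^bsub>A\<^esub> Sm = carrier A"
    and independent: "S \<inter> Sm = {\<zero>\<^bsub>A\<^esub>}"
    and even_odd: "\<lbrakk>s \<in> S; \<alpha> \<in> Sm\<rbrakk> \<Longrightarrow> s \<otimes>\<^bsub>A\<^esub> \<alpha> \<in> Sm"
    and odd_even: "\<lbrakk>\<alpha> \<in> Sm; s \<in> S\<rbrakk> \<Longrightarrow> \<alpha> \<otimes>\<^bsub>A\<^esub> s \<in> Sm"
    and odd_odd: "\<lbrakk>\<alpha> \<in> Sm; \<beta> \<in> Sm\<rbrakk> \<Longrightarrow> \<alpha> \<otimes>\<^bsub>A\<^esub> \<beta> \<in> S"

abbreviation even_ring :: "('a, 'r) ring_scheme \<Rightarrow> 'a set \<Rightarrow> ('a, 'r) ring_scheme" where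
  "even_ring A S \<equiv> A\<lparr>carrier := S\<rparr>"

definition graded_phi ::
  "('a, 'r) ring_scheme \<Rightarrow> 'a set \<Rightarrow> 'a set \<Rightarrow> ('a \<times> 'a \<Rightarrow>\<^sub>0 int) set \<Rightarrow> 'a" where
  "graded_phi A S Sm =
     tensor_lift (even_ring A S) (mult_bimodule A Sm) (mult_bimodule A Sm)
       (add_monoid (even_ring A S)) (\<lambda>\<alpha> \<beta>. \<alpha> \<otimes>\<^bsub>A\<^esub> \<beta>)"

definition action_map ::
  "('a, 'r) ring_scheme \<Rightarrow> 'a set \<Rightarrow> 'a set \<Rightarrow> ('a, 'm) module \<Rightarrow> ('a \<times> 'm \<Rightarrow>\<^sub>0 int) set \<Rightarrow> 'm" where
  "action_map A S Sm M =
     tensor_lift (even_ring A S) (mult_bimodule A Sm) (restrict_scalars S M)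
       (add_monoid M) (\<lambda>\<alpha> x. \<alpha> \<odot>\<^bsub>M\<^esub> x)"

end

theory Submission
  imports Defs
begin

text \<open>A module over \<open>S \<oplus> S\<^sup>-\<close> is an \<open>S\<close>-module \<open>N\<close> with an action of the odd elements, that is, a
  biadditive map \<open>S\<^sup>- \<times> N \<rightarrow> N\<close> that is \<open>S\<close>-linear in the odd argument, balanced over \<open>S\<close>, and
  satisfies \<open>\<alpha> (\<beta> x) = (\<alpha> \<beta>) x\<close>. By the universal property of the tensor product the first three
  conditions say that the action is the same thing as an \<open>S\<close>-homomorphism
  \<open>\<theta> : S\<^sup>- \<otimes> N \<rightarrow> N\<close>. Both sides of the compatibility equation are additive on
  \<open>S\<^sup>- \<otimes> (S\<^sup>- \<otimes> N)\<close>, so the equation may be tested on \<open>\<alpha> \<otimes> (\<beta> \<otimes> x)\<close>, where it becomes the last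
  condition (\<open>compatible_iff\<close>). In the same way, an \<open>S\<close>-homomorphism is a morphism of pairs if and only
  if it commutes with the odd actions (\<open>pair_morphism_iff\<close>), which is to say that it is linear over the
  whole graded ring (\<open>module_homs_iff_even_odd\<close>).

  The inverse functor sends \<open>(N, \<theta>)\<close> to \<open>N\<close> with the scalar multiplication
  \<open>(s + \<alpha>) x = s x + \<theta> (\<alpha> \<otimes> x)\<close> (\<open>left_module_extend_scalars\<close>) and is the identity on morphisms.
  Composing the two functors on objects gives back the same module and the same \<open>\<theta>\<close>, since a
  homomorphism on a tensor product is determined by its values on pure tensors
  (\<open>tensor_hom_eqI\<close>). These are equalities of records because normal modules and extensional
  homomorphisms carry no junk values off the carriers.\<close>

section \<open>Maps on tensor products\<close>

lemma tensor_lift_spec: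
  assumes "closed_ops R A N" "comm_group P" "balanced R A N P b"
  shows tensor_lift_hom: "tensor_lift R A N P b \<in> hom (tensor_group R A N) P"
    and tensor_lift_extensional: "tensor_lift R A N P b \<in> extensional (carrier (tensor_group R A N))"
    and tensor_lift_pure: "\<And>a x. a \<in> carrier A \<Longrightarrow> x \<in> carrier N \<Longrightarrow>
      tensor_lift R A N P b (pure_tensor R A N a x) = b a x"
  using theI'[OF tensor_lift_unique[OF assms]] unfolding tensor_lift_def by blast+

lemma tensor_hom_eqI:
  assumes c: "closed_ops R A N" and P: "comm_group P"
    and f: "f \<in> hom (tensor_group R A N) P" and g: "g \<in> hom (tensor_group R A N) P"
    and eq: "\<And>a x. a \<in> carrier A \<Longrightarrow> x \<in> carrier N \<Longrightarrow>
      f (pure_tensor R A N a x) = g (pure_tensor R A N a x)"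
    and t: "t \<in> carrier (tensor_group R A N)"
  shows "f t = g t"
proof -
  have T: "Group.group (tensor_group R A N)" and P': "Group.group P"
    using tensor_group_comm[OF c] P by (simp_all add: comm_group.axioms(2))
  interpret f: group_hom "tensor_group R A N" P f
    using f T P' by (simp add: group_hom_def group_hom_axioms_def)
  interpret g: group_hom "tensor_group R A N" P g
    using g T P' by (simp add: group_hom_def group_hom_axioms_def)
  show ?thesis using c t by (induction t rule: tensor_induct) (use eq in auto)
qed

lemma balanced_pure_tensor:
  assumes c: "closed_ops R A N"
  shows "balanced R A N (tensor_group R A N) (pure_tensor R A N)"
proof -
  let ?F = "free_Abelian_group (carrier A \<times> carrier N)"
  let ?T = "tensor_group R A N"
  let ?q = "\<lambda>z. tensor_kernel R A N #>\<^bsub>?F\<^esub> z"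
  interpret q: group_hom ?F ?T ?q by (rule tensor_quotient_hom[OF c])
  interpret n: normal "tensor_kernel R A N" ?F by (rule tensor_kernel_normal[OF c])
  have rel: "?q z = \<one>\<^bsub>?T\<^esub>" if "z \<in> tensor_relations R A N" for z
    using that n.rcos_const[OF group_free_Abelian_group, of z] generate.incl[OF that, of ?F]
    by (simp add: tensor_group_def tensor_kernel_def FactGroup_def)
  have diff: "?q (u - v) = ?q u \<otimes>\<^bsub>?T\<^esub> inv\<^bsub>?T\<^esub> ?q v" if "u \<in> carrier ?F" "v \<in> carrier ?F" for u v
  proof -
    have "u - v = u \<otimes>\<^bsub>?F\<^esub> inv\<^bsub>?F\<^esub> v" using that by simp
    then show ?thesis
      using that q.hom_mult[of u "inv\<^bsub>?F\<^esub> v"] q.hom_inv[of v]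
        group.inv_closed[OF group_free_Abelian_group, of v] by metis
  qed
  have two: "?q u = ?q v" if "u - v \<in> tensor_relations R A N" "u \<in> carrier ?F" "v \<in> carrier ?F" for u v
  proof -
    have "?q u \<otimes>\<^bsub>?T\<^esub> inv\<^bsub>?T\<^esub> ?q v = \<one>\<^bsub>?T\<^esub>"
      by (rule trans[OF diff[OF that(2,3), symmetric] rel[OF that(1)]])
    then have "inv\<^bsub>?T\<^esub> (inv\<^bsub>?T\<^esub> ?q v) = ?q u"
      by (rule q.H.inv_equality) (use q.hom_closed that in \<open>blast intro: q.H.inv_closed\<close>)+
    then show ?thesis by (simp only: q.H.inv_inv[OF q.hom_closed[OF that(3)]])
  qed
  \<comment> \<open>The relations with three terms reduce to those with two, in the form \<open>u - (v + w)\<close>.\<close>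
  have three: "?q u = ?q v \<otimes>\<^bsub>?T\<^esub> ?q w" if "u - v - w \<in> tensor_relations R A N"
    "u \<in> carrier ?F" "v \<in> carrier ?F" "w \<in> carrier ?F" for u v w
  proof -
    have vw: "v + w \<in> carrier ?F" using that q.G.m_closed[of v w] by simp
    have "u - (v + w) \<in> tensor_relations R A N" using that(1) by (simp add: diff_diff_eq)
    then have "?q u = ?q (v + w)" using two vw that(2) by blast
    also have "\<dots> = ?q v \<otimes>\<^bsub>?T\<^esub> ?q w" using q.hom_mult[OF that(3,4)] by simp
    finally show ?thesis .
  qed
  have fr: "frag_of (a, x) \<in> carrier ?F" if "a \<in> carrier A" "x \<in> carrier N" for a x using that by simp
  show ?thesis
    unfolding balanced_def
  proof (intro conjI ballI)
    fix a x assume "a \<in> carrier A" "x \<in> carrier N"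
    then show "pure_tensor R A N a x \<in> carrier ?T" by (rule pure_tensor_closed[OF c])
  next
    fix a a' x assume m: "a \<in> carrier A" "a' \<in> carrier A" "x \<in> carrier N"
    show "pure_tensor R A N (a \<oplus>\<^bsub>A\<^esub> a') x = pure_tensor R A N a x \<otimes>\<^bsub>?T\<^esub> pure_tensor R A N a' x"
      unfolding pure_tensor_def
      by (rule three) (use m c in \<open>auto simp: tensor_relations_def closed_ops_def\<close>)
  next
    fix a x y assume m: "a \<in> carrier A" "x \<in> carrier N" "y \<in> carrier N"
    show "pure_tensor R A N a (x \<oplus>\<^bsub>N\<^esub> y) = pure_tensor R A N a x \<otimes>\<^bsub>?T\<^esub> pure_tensor R A N a y"
      unfolding pure_tensor_def
      by (rule three) (use m c in \<open>auto simp: tensor_relations_def closed_ops_def\<close>)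
  next
    fix a r x assume m: "a \<in> carrier A" "r \<in> carrier R" "x \<in> carrier N"
    show "pure_tensor R A N (rsmult A a r) x = pure_tensor R A N a (r \<odot>\<^bsub>N\<^esub> x)"
      unfolding pure_tensor_def
      by (rule two) (use m c in \<open>auto simp: tensor_relations_def closed_ops_def\<close>)
  qed
qed

lemma
  assumes "closed_ops R A N"
  shows pure_tensor_add_left: "\<lbrakk>a \<in> carrier A; a' \<in> carrier A; x \<in> carrier N\<rbrakk> \<Longrightarrow>
      pure_tensor R A N (a \<oplus>\<^bsub>A\<^esub> a') x =
      pure_tensor R A N a x \<otimes>\<^bsub>tensor_group R A N\<^esub> pure_tensor R A N a' x"
    and pure_tensor_add_right: "\<lbrakk>a \<in> carrier A; x \<in> carrier N; y \<in> carrier N\<rbrakk> \<Longrightarrow>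
      pure_tensor R A N a (x \<oplus>\<^bsub>N\<^esub> y) =
      pure_tensor R A N a x \<otimes>\<^bsub>tensor_group R A N\<^esub> pure_tensor R A N a y"
    and pure_tensor_rsmult: "\<lbrakk>a \<in> carrier A; r \<in> carrier R; x \<in> carrier N\<rbrakk> \<Longrightarrow>
      pure_tensor R A N (rsmult A a r) x = pure_tensor R A N a (r \<odot>\<^bsub>N\<^esub> x)"
  using balanced_pure_tensor[OF assms] unfolding balanced_def by blast+

lemma balanced_compose_pure_tensor:
  assumes c': "closed_ops R A' N'"
    and g: "\<And>a. a \<in> carrier A \<Longrightarrow> g a \<in> carrier A'"
      "\<And>a b. a \<in> carrier A \<Longrightarrow> b \<in> carrier A \<Longrightarrow> g (a \<oplus>\<^bsub>A\<^esub> b) = g a \<oplus>\<^bsub>A'\<^esub> g b"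
      "\<And>a r. a \<in> carrier A \<Longrightarrow> r \<in> carrier R \<Longrightarrow> g (rsmult A a r) = rsmult A' (g a) r"
    and f: "\<And>x. x \<in> carrier N \<Longrightarrow> f x \<in> carrier N'"
      "\<And>x y. x \<in> carrier N \<Longrightarrow> y \<in> carrier N \<Longrightarrow> f (x \<oplus>\<^bsub>N\<^esub> y) = f x \<oplus>\<^bsub>N'\<^esub> f y"
      "\<And>r x. r \<in> carrier R \<Longrightarrow> x \<in> carrier N \<Longrightarrow> f (r \<odot>\<^bsub>N\<^esub> x) = r \<odot>\<^bsub>N'\<^esub> f x"
  shows "balanced R A N (tensor_group R A' N') (\<lambda>a x. pure_tensor R A' N' (g a) (f x))"
  using balanced_pure_tensor[OF c'] unfolding balanced_def by (simp add: f g)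

lemma tensor_map_spec:
  assumes c: "closed_ops R A N" and c': "closed_ops R A' N'"
    and g: "\<And>a. a \<in> carrier A \<Longrightarrow> g a \<in> carrier A'"
      "\<And>a b. a \<in> carrier A \<Longrightarrow> b \<in> carrier A \<Longrightarrow> g (a \<oplus>\<^bsub>A\<^esub> b) = g a \<oplus>\<^bsub>A'\<^esub> g b"
      "\<And>a r. a \<in> carrier A \<Longrightarrow> r \<in> carrier R \<Longrightarrow> g (rsmult A a r) = rsmult A' (g a) r"
    and f: "\<And>x. x \<in> carrier N \<Longrightarrow> f x \<in> carrier N'"
      "\<And>x y. x \<in> carrier N \<Longrightarrow> y \<in> carrier N \<Longrightarrow> f (x \<oplus>\<^bsub>N\<^esub> y) = f x \<oplus>\<^bsub>N'\<^esub> f y"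
      "\<And>r x. r \<in> carrier R \<Longrightarrow> x \<in> carrier N \<Longrightarrow> f (r \<odot>\<^bsub>N\<^esub> x) = r \<odot>\<^bsub>N'\<^esub> f x"
  shows tensor_map_hom:
      "tensor_map R A N A' N' g f \<in> hom (tensor_group R A N) (tensor_group R A' N')"
    and tensor_map_pure: "\<And>a x. a \<in> carrier A \<Longrightarrow> x \<in> carrier N \<Longrightarrow>
      tensor_map R A N A' N' g f (pure_tensor R A N a x) = pure_tensor R A' N' (g a) (f x)"
  unfolding tensor_map_def
  using tensor_lift_hom[OF c tensor_group_comm[OF c'] balanced_compose_pure_tensor[OF c' g f]]
    tensor_lift_pure[OF c tensor_group_comm[OF c'] balanced_compose_pure_tensor[OF c' g f]]
  by blast+


section \<open>Bimodules and pairs\<close>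

text \<open>Homomorphisms on a tensor product are handled through their additive structure, since
  \<open>tensor_hom_eqI\<close> compares homomorphisms of groups.\<close>

lemma module_homs_hom: "f \<in> module_homs R M N \<Longrightarrow> f \<in> hom (add_monoid M) (add_monoid N)"
  unfolding module_homs_def by (auto intro!: homI)

lemma module_homs_id:
  assumes "left_module R M"
  shows "(\<lambda>x\<in>carrier M. x) \<in> module_homs R M M"
  unfolding module_homs_def
  using left_module.smult_closed[OF assms] abelian_groupE(1)[OF left_module.axioms(2)[OF assms]]
  by auto

lemma module_homs_compose:
  assumes "left_module R L" "f \<in> module_homs R L M" "g \<in> module_homs R M N"
  shows "compose (carrier L) g f \<in> module_homs R L N"
  using assms(2,3) left_module.smult_closed[OF assms(1)]
    abelian_groupE(1)[OF left_module.axioms(2)[OF assms(1)]]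
  unfolding module_homs_def by (auto simp: compose_def PiE_def Pi_def)

lemma is_category_module_category: "is_category (module_category R)"
proof -
  have ext: "f \<in> extensional (carrier M)" and mem: "f \<in> carrier M \<rightarrow> carrier N"
    if "f \<in> module_homs R M N" for f M N
    using that by (auto simp: module_homs_def PiE_def)
  show ?thesis
    unfolding is_category_def module_category_def
    by (auto simp: normal_module_def module_homs_id module_homs_compose ext funcset_mem[OF mem]
        compose_assoc[OF mem] intro!: compose_Id Id_compose)
qed

text \<open>The part of the axioms of an \<open>(R, R)\<close>-bimodule that the constructions on pairs use: it is
  closed under the operations, the two scalar multiplications are additive in the bimodule
  argument, and they commute with each other. The group axioms and the laws in
  the ring argument are left out: the tensor product, a quotient of a free abelian group, is a
  group without them.\<close>

locale ring_bimodule = R?: ring R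
  for R :: "('a, 'r) ring_scheme" (structure) and B :: "('a, 'b) bimodule" (structure) +
  assumes add_closed: "\<lbrakk>a \<in> carrier B; b \<in> carrier B\<rbrakk> \<Longrightarrow> a \<oplus>\<^bsub>B\<^esub> b \<in> carrier B"
    and lsmult_closed: "\<lbrakk>r \<in> carrier R; b \<in> carrier B\<rbrakk> \<Longrightarrow> r \<odot>\<^bsub>B\<^esub> b \<in> carrier B"
    and rsmult_closed: "\<lbrakk>r \<in> carrier R; b \<in> carrier B\<rbrakk> \<Longrightarrow> rsmult B b r \<in> carrier B"
    and lsmult_add: "\<lbrakk>r \<in> carrier R; a \<in> carrier B; b \<in> carrier B\<rbrakk>
      \<Longrightarrow> r \<odot>\<^bsub>B\<^esub> (a \<oplus>\<^bsub>B\<^esub> b) = r \<odot>\<^bsub>B\<^esub> a \<oplus>\<^bsub>B\<^esub> r \<odot>\<^bsub>B\<^esub> b"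
    and rsmult_add: "\<lbrakk>r \<in> carrier R; a \<in> carrier B; b \<in> carrier B\<rbrakk>
      \<Longrightarrow> rsmult B (a \<oplus>\<^bsub>B\<^esub> b) r = rsmult B a r \<oplus>\<^bsub>B\<^esub> rsmult B b r"
    and smult_commute: "\<lbrakk>r \<in> carrier R; s \<in> carrier R; b \<in> carrier B\<rbrakk>
      \<Longrightarrow> rsmult B (r \<odot>\<^bsub>B\<^esub> b) s = r \<odot>\<^bsub>B\<^esub> rsmult B b s"
begin

lemma closed_ops_left_module:
  assumes "left_module R N"
  shows "closed_ops R B N"
proof -
  interpret N: left_module R N by (rule assms)
  show ?thesis
    by (simp add: closed_ops_def add_closed rsmult_closed N.smult_closed)
qed

lemma closed_ops_self: "closed_ops R B B"
  unfolding closed_ops_def using add_closed lsmult_closed rsmult_closed by simp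

lemma
  assumes c: "closed_ops R B N" and r: "r \<in> carrier R"
  shows tensor_smult_hom: "smult (tensor R B N) r \<in> hom (tensor_group R B N) (tensor_group R B N)"
    and tensor_smult_pure: "\<And>b x. b \<in> carrier B \<Longrightarrow> x \<in> carrier N \<Longrightarrow>
      r \<odot>\<^bsub>tensor R B N\<^esub> pure_tensor R B N b x = pure_tensor R B N (r \<odot>\<^bsub>B\<^esub> b) x"
proof -
  show "smult (tensor R B N) r \<in> hom (tensor_group R B N) (tensor_group R B N)"
    unfolding tensor_def
    by simp (rule tensor_map_hom[OF c c]; use r in \<open>simp add: lsmult_closed lsmult_add smult_commute\<close>)
  fix b x assume b: "b \<in> carrier B" and x: "x \<in> carrier N"
  show "r \<odot>\<^bsub>tensor R B N\<^esub> pure_tensor R B N b x = pure_tensor R B N (r \<odot>\<^bsub>B\<^esub> b) x"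
    unfolding tensor_def
    by simp (rule tensor_map_pure[OF c c]; use r b x in \<open>simp add: lsmult_closed lsmult_add smult_commute\<close>)
qed

lemma closed_ops_tensor:
  assumes c: "closed_ops R B N"
  shows "closed_ops R B (tensor R B N)"
proof -
  interpret T: comm_group "tensor_group R B N" by (rule tensor_group_comm[OF c])
  have "r \<odot>\<^bsub>tensor R B N\<^esub> t \<in> carrier (tensor_group R B N)"
    if "r \<in> carrier R" "t \<in> carrier (tensor_group R B N)" for r t
    using hom_in_carrier[OF tensor_smult_hom[OF c that(1)] that(2)] .
  then show ?thesis
    using add_closed rsmult_closed unfolding closed_ops_def by (simp add: tensor_def)
qed

lemma
  assumes r: "r \<in> carrier R"
  shows bimodule_tensor_rsmult_hom:
      "(\<lambda>t. rsmult (bimodule_tensor R B B) t r) \<in> hom (tensor_group R B B) (tensor_group R B B)"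
    and bimodule_tensor_rsmult_pure: "\<And>a b. a \<in> carrier B \<Longrightarrow> b \<in> carrier B \<Longrightarrow>
      rsmult (bimodule_tensor R B B) (pure_tensor R B B a b) r = pure_tensor R B B a (rsmult B b r)"
proof -
  have e: "(\<lambda>t. rsmult (bimodule_tensor R B B) t r) =
      tensor_map R B B B B (\<lambda>a. a) (\<lambda>b. rsmult B b r)"
    unfolding bimodule_tensor_def module.extend_def by simp
  show "(\<lambda>t. rsmult (bimodule_tensor R B B) t r) \<in> hom (tensor_group R B B) (tensor_group R B B)"
    unfolding e
    by (rule tensor_map_hom[OF closed_ops_self closed_ops_self];
        use r in \<open>simp add: rsmult_closed rsmult_add smult_commute\<close>)
  fix a b assume ab: "a \<in> carrier B" "b \<in> carrier B"
  show "rsmult (bimodule_tensor R B B) (pure_tensor R B B a b) r = pure_tensor R B B a (rsmult B b r)"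
    unfolding fun_cong[OF e]
    by (rule tensor_map_pure[OF closed_ops_self closed_ops_self];
        use r ab in \<open>simp add: rsmult_closed rsmult_add smult_commute\<close>)
qed

lemma hom_add_monoid_tensor: "hom (add_monoid (tensor R B N)) P = hom (tensor_group R B N) P"
  by (simp add: hom_def tensor_def)

lemma module_homs_tensor_hom:
  "f \<in> module_homs R (tensor R B N) M \<Longrightarrow> f \<in> hom (tensor_group R B N) (add_monoid M)"
  using module_homs_hom[of f R "tensor R B N" M] by (simp add: hom_add_monoid_tensor)

lemma module_homs_tensorI:
  assumes c: "closed_ops R B N" and M: "left_module R M"
    and f: "f \<in> hom (tensor_group R B N) (add_monoid M)"
    and ext: "f \<in> extensional (carrier (tensor_group R B N))"
    and lin: "\<And>r b x. \<lbrakk>r \<in> carrier R; b \<in> carrier B; x \<in> carrier N\<rbrakk> \<Longrightarrow>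
      f (pure_tensor R B N (r \<odot>\<^bsub>B\<^esub> b) x) = r \<odot>\<^bsub>M\<^esub> f (pure_tensor R B N b x)"
  shows "f \<in> module_homs R (tensor R B N) M"
proof -
  interpret M: left_module R M by (rule M)
  have mem: "f t \<in> carrier M" if "t \<in> carrier (tensor_group R B N)" for t
    using hom_in_carrier[OF f that] by simp
  have add: "f (t \<otimes>\<^bsub>tensor_group R B N\<^esub> u) = f t \<oplus>\<^bsub>M\<^esub> f u"
    if "t \<in> carrier (tensor_group R B N)" "u \<in> carrier (tensor_group R B N)" for t u
    using hom_mult[OF f that] by simp
  have "f (r \<odot>\<^bsub>tensor R B N\<^esub> t) = r \<odot>\<^bsub>M\<^esub> f t"
    if r: "r \<in> carrier R" and t: "t \<in> carrier (tensor_group R B N)" for r t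
  proof -
    have "(f \<circ> smult (tensor R B N) r) t = (\<lambda>t. r \<odot>\<^bsub>M\<^esub> f t) t"
    proof (rule tensor_hom_eqI[OF c M.a_comm_group hom_compose[OF tensor_smult_hom[OF c r] f] _ _ t])
      show "(\<lambda>t. r \<odot>\<^bsub>M\<^esub> f t) \<in> hom (tensor_group R B N) (add_monoid M)"
        by (rule homI) (simp_all add: mem add r M.smult_closed M.smult_r_distr)
    qed (simp add: tensor_smult_pure[OF c r] lin r)
    then show ?thesis by simp
  qed
  then show ?thesis
    using ext mem add by (auto simp: module_homs_def tensor_def PiE_def)
qed

lemma pure_tensor_right_hom:
  assumes c: "closed_ops R B N" and b: "b \<in> carrier B"
  shows "pure_tensor R B N b \<in> hom (add_monoid N) (tensor_group R B N)"
  using balanced_pure_tensor[OF c] b unfolding balanced_def by (auto intro!: homI)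

text \<open>For a fixed left factor, the pure tensor is additive in the right one, so that
  \<open>tensor_hom_eqI\<close> applies in each factor.\<close>

lemma iterated_tensor_hom_eqI:
  assumes c: "closed_ops R B N" and P: "comm_group P"
    and f: "f \<in> hom (tensor_group R B (tensor R B N)) P"
    and g: "g \<in> hom (tensor_group R B (tensor R B N)) P"
    and eq: "\<And>a b x. \<lbrakk>a \<in> carrier B; b \<in> carrier B; x \<in> carrier N\<rbrakk> \<Longrightarrow>
      f (pure_tensor R B (tensor R B N) a (pure_tensor R B N b x)) =
      g (pure_tensor R B (tensor R B N) a (pure_tensor R B N b x))"
    and t: "t \<in> carrier (tensor_group R B (tensor R B N))"
  shows "f t = g t"
proof (rule tensor_hom_eqI[OF closed_ops_tensor[OF c] P f g _ t])
  fix a u assume a: "a \<in> carrier B" and u: "u \<in> carrier (tensor R B N)"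
  let ?p = "pure_tensor R B (tensor R B N) a"
  have p: "?p \<in> hom (tensor_group R B N) (tensor_group R B (tensor R B N))"
    using pure_tensor_right_hom[OF closed_ops_tensor[OF c] a] by (simp add: hom_add_monoid_tensor)
  have "(f \<circ> ?p) u = (g \<circ> ?p) u"
    by (rule tensor_hom_eqI[OF c P hom_compose[OF p f] hom_compose[OF p g]])
      (use eq a u in \<open>auto simp: tensor_def\<close>)
  then show "f (?p u) = g (?p u)" by simp
qed

lemma
  assumes c: "closed_ops R B M" and c': "closed_ops R B N" and f: "f \<in> module_homs R M N"
  shows D_map_hom: "D_map R B M N f \<in> hom (tensor_group R B M) (tensor_group R B N)"
    and D_map_pure: "\<And>b x. b \<in> carrier B \<Longrightarrow> x \<in> carrier M \<Longrightarrow>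
      D_map R B M N f (pure_tensor R B M b x) = pure_tensor R B N b (f x)"
proof -
  show "D_map R B M N f \<in> hom (tensor_group R B M) (tensor_group R B N)"
    unfolding D_map_def
    by (rule tensor_map_hom[OF c c']) (use f in \<open>auto simp: module_homs_def\<close>)
  fix b x assume b: "b \<in> carrier B" and x: "x \<in> carrier M"
  show "D_map R B M N f (pure_tensor R B M b x) = pure_tensor R B N b (f x)"
    unfolding D_map_def
    by (rule tensor_map_pure[OF c c']) (use f b x in \<open>auto simp: module_homs_def\<close>)
qed

text \<open>The square that defines a morphism of pairs commutes as soon as it commutes on pure tensors.\<close>

lemma pair_morphism_iff:
  assumes N: "left_module R N" and N': "left_module R N'"
    and th: "\<theta> \<in> module_homs R (tensor R B N) N" and th': "\<theta>' \<in> module_homs R (tensor R B N') N'"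
    and f: "f \<in> module_homs R N N'"
  shows "compose (carrier (tensor R B N)) f \<theta> = compose (carrier (tensor R B N)) \<theta>' (D_map R B N N' f)
    \<longleftrightarrow> (\<forall>b\<in>carrier B. \<forall>x\<in>carrier N. f (\<theta> (pure_tensor R B N b x)) = \<theta>' (pure_tensor R B N' b (f x)))"
    (is "?L = ?R \<longleftrightarrow> ?P")
proof -
  note c = closed_ops_left_module[OF N] and c' = closed_ops_left_module[OF N']
  have fth: "f \<circ> \<theta> \<in> hom (tensor_group R B N) (add_monoid N')"
    by (rule hom_compose[OF module_homs_tensor_hom[OF th] module_homs_hom[OF f]])
  have thf: "\<theta>' \<circ> D_map R B N N' f \<in> hom (tensor_group R B N) (add_monoid N')"
    by (rule hom_compose[OF D_map_hom[OF c c' f] module_homs_tensor_hom[OF th']])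
  have ct: "carrier (tensor R B N) = carrier (tensor_group R B N)" by (simp add: tensor_def)
  show ?thesis
  proof
    assume eq: "?L = ?R"
    show ?P
    proof (intro ballI)
      fix b x assume b: "b \<in> carrier B" and x: "x \<in> carrier N"
      show "f (\<theta> (pure_tensor R B N b x)) = \<theta>' (pure_tensor R B N' b (f x))"
        using fun_cong[OF eq, of "pure_tensor R B N b x"] pure_tensor_closed[OF c b x]
        by (simp add: compose_def ct D_map_pure[OF c c' f b x])
    qed
  next
    assume P: ?P
    have "(f \<circ> \<theta>) t = (\<theta>' \<circ> D_map R B N N' f) t" if "t \<in> carrier (tensor_group R B N)" for t
      by (rule tensor_hom_eqI[OF c abelian_group.a_comm_group[OF left_module.axioms(2)[OF N']] fth thf _ that])
        (use P in \<open>simp add: D_map_pure[OF c c' f]\<close>)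
    then show "?L = ?R" by (auto simp: compose_def ct)
  qed
qed

lemma closed_ops_bimodule_tensor:
  assumes N: "left_module R N"
  shows "closed_ops R (bimodule_tensor R B B) N"
proof -
  interpret T: comm_group "tensor_group R B B" by (rule tensor_group_comm[OF closed_ops_self])
  have "rsmult (bimodule_tensor R B B) t r \<in> carrier (tensor_group R B B)"
    if "r \<in> carrier R" "t \<in> carrier (tensor_group R B B)" for r t
    using hom_in_carrier[OF bimodule_tensor_rsmult_hom[OF that(1)] that(2)] .
  then show ?thesis
    using left_module.smult_closed[OF N] abelian_groupE(1)[OF left_module.axioms(2)[OF N]]
    unfolding closed_ops_def
    by (simp add: bimodule_tensor_def tensor_def module.extend_def)
qed

lemma
  assumes N: "left_module R N"
  shows tensor_assoc_hom: "tensor_assoc R B B N \<in>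
      hom (tensor_group R B (tensor R B N)) (tensor_group R (bimodule_tensor R B B) N)"
    and tensor_assoc_pure: "\<And>a b x. \<lbrakk>a \<in> carrier B; b \<in> carrier B; x \<in> carrier N\<rbrakk> \<Longrightarrow>
      tensor_assoc R B B N (pure_tensor R B (tensor R B N) a (pure_tensor R B N b x)) =
      pure_tensor R (bimodule_tensor R B B) N (pure_tensor R B B a b) x"
proof -
  let ?BB = "bimodule_tensor R B B"
  let ?T = "tensor_group R ?BB N"
  define L where "L = (\<lambda>a. tensor_lift R B N ?T (\<lambda>b x. pure_tensor R ?BB N (pure_tensor R B B a b) x))"
  note c = closed_ops_left_module[OF N]
  note cBB = closed_ops_bimodule_tensor[OF N]
  note T = tensor_group_comm[OF cBB]
  interpret T: comm_group ?T by (rule T)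
  have BB: "carrier ?BB = carrier (tensor_group R B B)" "add ?BB = mult (tensor_group R B B)"
    by (simp_all add: bimodule_tensor_def tensor_def module.extend_def)
  note closed = pure_tensor_closed[OF closed_ops_self] pure_tensor_closed[OF cBB, unfolded BB]
  note add_left = pure_tensor_add_left[OF closed_ops_self] pure_tensor_add_left[OF cBB, unfolded BB]
  note add_right = pure_tensor_add_right[OF closed_ops_self] pure_tensor_add_right[OF cBB, unfolded BB]
  note move = pure_tensor_rsmult[OF closed_ops_self] pure_tensor_rsmult[OF cBB, unfolded BB]
  have inner: "balanced R B N ?T (\<lambda>b x. pure_tensor R ?BB N (pure_tensor R B B a b) x)"
    if a: "a \<in> carrier B" for a
    unfolding balanced_def
  proof (intro conjI ballI)
    fix b r x assume m: "b \<in> carrier B" "r \<in> carrier R" "x \<in> carrier N"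
    show "pure_tensor R ?BB N (pure_tensor R B B a (rsmult B b r)) x =
        pure_tensor R ?BB N (pure_tensor R B B a b) (r \<odot>\<^bsub>N\<^esub> x)"
      unfolding bimodule_tensor_rsmult_pure[OF m(2) a m(1), symmetric]
      by (rule move(2)[OF closed(1)[OF a m(1)] m(2,3)])
  qed (simp_all add: a closed add_left add_right)
  have L_hom: "L a \<in> hom (tensor_group R B N) ?T" if "a \<in> carrier B" for a
    unfolding L_def by (rule tensor_lift_hom[OF c T inner[OF that]])
  have L_pure: "L a (pure_tensor R B N b x) = pure_tensor R ?BB N (pure_tensor R B B a b) x"
    if "a \<in> carrier B" "b \<in> carrier B" "x \<in> carrier N" for a b x
    unfolding L_def by (rule tensor_lift_pure[OF c T inner[OF that(1)] that(2,3)])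
  have DN: "carrier (tensor R B N) = carrier (tensor_group R B N)"
    "add (tensor R B N) = mult (tensor_group R B N)"
    by (simp_all add: tensor_def)
  have outer: "balanced R B (tensor R B N) ?T L"
    unfolding balanced_def DN
  proof (intro conjI ballI)
    fix a t assume "a \<in> carrier B" "t \<in> carrier (tensor_group R B N)"
    then show "L a t \<in> carrier ?T" by (rule hom_in_carrier[OF L_hom])
  next
    fix a t u assume "a \<in> carrier B" "t \<in> carrier (tensor_group R B N)" "u \<in> carrier (tensor_group R B N)"
    then show "L a (t \<otimes>\<^bsub>tensor_group R B N\<^esub> u) = L a t \<otimes>\<^bsub>?T\<^esub> L a u"
      by (rule hom_mult[OF L_hom])
  next
    fix a a' t
    assume a: "a \<in> carrier B" "a' \<in> carrier B" and t: "t \<in> carrier (tensor_group R B N)"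
    have s: "(\<lambda>t. L a t \<otimes>\<^bsub>?T\<^esub> L a' t) \<in> hom (tensor_group R B N) ?T"
      by (rule T.hom_group_mult[OF L_hom[OF a(1)] L_hom[OF a(2)]])
    show "L (a \<oplus>\<^bsub>B\<^esub> a') t = L a t \<otimes>\<^bsub>?T\<^esub> L a' t"
      by (rule tensor_hom_eqI[OF c T L_hom[OF add_closed[OF a]] s _ t])
        (simp add: a L_pure add_closed closed add_left)
  next
    fix a r t
    assume a: "a \<in> carrier B" and r: "r \<in> carrier R" and t: "t \<in> carrier (tensor_group R B N)"
    have "L (rsmult B a r) t = (L a \<circ> smult (tensor R B N) r) t"
      by (rule tensor_hom_eqI[OF c T L_hom[OF rsmult_closed[OF r a]]
            hom_compose[OF tensor_smult_hom[OF c r] L_hom[OF a]] _ t])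
        (simp add: a r L_pure tensor_smult_pure[OF c r] lsmult_closed rsmult_closed move)
    then show "L (rsmult B a r) t = L a (r \<odot>\<^bsub>tensor R B N\<^esub> t)" by simp
  qed
  show "tensor_assoc R B B N \<in> hom (tensor_group R B (tensor R B N)) ?T"
    unfolding tensor_assoc_def
    by (rule tensor_lift_hom[OF closed_ops_tensor[OF c] T outer[unfolded L_def]])
  fix a b x assume m: "a \<in> carrier B" "b \<in> carrier B" "x \<in> carrier N"
  show "tensor_assoc R B B N (pure_tensor R B (tensor R B N) a (pure_tensor R B N b x)) =
      pure_tensor R ?BB N (pure_tensor R B B a b) x"
    unfolding tensor_assoc_def
    by (rule trans[OF tensor_lift_pure[OF closed_ops_tensor[OF c] T outer[unfolded L_def] m(1)]
          L_pure[OF m, unfolded L_def]])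
      (simp add: DN pure_tensor_closed[OF c m(2,3)])
qed

lemma
  assumes N: "left_module R N"
  shows closed_ops_ring: "closed_ops R (mult_bimodule R (carrier R)) N"
    and tensor_unit_hom: "tensor_unit R N \<in>
      hom (tensor_group R (mult_bimodule R (carrier R)) N) (add_monoid N)"
    and tensor_unit_pure: "\<And>r x. r \<in> carrier R \<Longrightarrow> x \<in> carrier N \<Longrightarrow>
      tensor_unit R N (pure_tensor R (mult_bimodule R (carrier R)) N r x) = r \<odot>\<^bsub>N\<^esub> x"
proof -
  interpret N: left_module R N by (rule N)
  show c: "closed_ops R (mult_bimodule R (carrier R)) N"
    by (simp add: closed_ops_def mult_bimodule_def N.smult_closed)
  have b: "balanced R (mult_bimodule R (carrier R)) N (add_monoid N) (smult N)"
    by (simp add: balanced_def mult_bimodule_def N.smult_closed N.smult_l_distr N.smult_r_distr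
        N.smult_assoc)
  show "tensor_unit R N \<in> hom (tensor_group R (mult_bimodule R (carrier R)) N) (add_monoid N)"
    unfolding tensor_unit_def by (rule tensor_lift_hom[OF c N.a_comm_group b])
  fix r x assume "r \<in> carrier R" "x \<in> carrier N"
  then show "tensor_unit R N (pure_tensor R (mult_bimodule R (carrier R)) N r x) = r \<odot>\<^bsub>N\<^esub> x"
    unfolding tensor_unit_def
    using tensor_lift_pure[OF c N.a_comm_group b] by (simp add: mult_bimodule_def)
qed

text \<open>On pure tensors, compatibility is the associativity law \<open>a (b x) = (a b) x\<close> for the action
  of \<open>B\<close> on \<open>N\<close> encoded by \<open>\<theta>\<close>, with \<open>a b\<close> read as \<open>\<phi> (a \<otimes> b)\<close>. Right linearity of \<open>\<phi>\<close>
  is what makes \<open>\<phi> \<otimes> id\<close> well defined.\<close>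

lemma compatible_iff:
  assumes N: "left_module R N" and th: "\<theta> \<in> module_homs R (tensor R B N) N"
    and phi: "\<phi> \<in> hom (tensor_group R B B) (add_monoid R)"
    and phi_right: "\<And>a b r. \<lbrakk>a \<in> carrier B; b \<in> carrier B; r \<in> carrier R\<rbrakk> \<Longrightarrow>
      \<phi> (pure_tensor R B B a (rsmult B b r)) = \<phi> (pure_tensor R B B a b) \<otimes> r"
  shows "compatible R B \<phi> N \<theta> \<longleftrightarrow>
    (\<forall>a\<in>carrier B. \<forall>b\<in>carrier B. \<forall>x\<in>carrier N.
      \<theta> (pure_tensor R B N a (\<theta> (pure_tensor R B N b x))) = \<phi> (pure_tensor R B B a b) \<odot>\<^bsub>N\<^esub> x)"
    (is "_ \<longleftrightarrow> ?P")
proof -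
  interpret N: left_module R N by (rule N)
  let ?DN = "tensor R B N" and ?BB = "bimodule_tensor R B B"
  let ?RR = "mult_bimodule R (carrier R)"
  let ?pt = "\<lambda>a b x. pure_tensor R B ?DN a (pure_tensor R B N b x)"
  let ?f = "\<theta> \<circ> D_map R B ?DN N \<theta>"
  let ?m = "tensor_map R ?BB N ?RR N \<phi> (\<lambda>x. x)"
  let ?g = "tensor_unit R N \<circ> (?m \<circ> tensor_assoc R B B N)"
  note c = closed_ops_left_module[OF N]
  note cD = closed_ops_tensor[OF c]
  note cBB = closed_ops_bimodule_tensor[OF N]
  have BB: "carrier ?BB = carrier (tensor_group R B B)" "add ?BB = mult (tensor_group R B B)"
    by (simp_all add: bimodule_tensor_def tensor_def module.extend_def)
  have DN: "carrier ?DN = carrier (tensor_group R B N)" by (simp add: tensor_def)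
  have phi_closed: "\<phi> t \<in> carrier R" if "t \<in> carrier (tensor_group R B B)" for t
    using hom_in_carrier[OF phi that] by simp
  have phi_add: "\<phi> (t \<otimes>\<^bsub>tensor_group R B B\<^esub> u) = \<phi> t \<oplus> \<phi> u"
    if "t \<in> carrier (tensor_group R B B)" "u \<in> carrier (tensor_group R B B)" for t u
    using hom_mult[OF phi that] by simp
  have phi_rsmult: "\<phi> (rsmult ?BB t r) = \<phi> t \<otimes> r"
    if t: "t \<in> carrier (tensor_group R B B)" and r: "r \<in> carrier R" for t r
  proof -
    have "(\<phi> \<circ> (\<lambda>t. rsmult ?BB t r)) t = (\<lambda>t. \<phi> t \<otimes> r) t"
    proof (rule tensor_hom_eqI[OF closed_ops_self a_comm_group
          hom_compose[OF bimodule_tensor_rsmult_hom[OF r] phi] _ _ t])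
      show "(\<lambda>t. \<phi> t \<otimes> r) \<in> hom (tensor_group R B B) (add_monoid R)"
        by (rule homI) (simp_all add: phi_closed phi_add r l_distr)
    qed (simp add: bimodule_tensor_rsmult_pure[OF r] phi_right r)
    then show ?thesis by simp
  qed
  have m: "?m \<in> hom (tensor_group R ?BB N) (tensor_group R ?RR N)"
    by (rule tensor_map_hom[OF cBB closed_ops_ring[OF N]])
      (simp_all add: BB mult_bimodule_def phi_closed phi_add phi_rsmult)
  have m_pure: "?m (pure_tensor R ?BB N t x) = pure_tensor R ?RR N (\<phi> t) x"
    if "t \<in> carrier (tensor_group R B B)" "x \<in> carrier N" for t x
    by (rule tensor_map_pure[OF cBB closed_ops_ring[OF N]])
      (simp_all add: BB mult_bimodule_def phi_closed phi_add phi_rsmult that)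
  have f: "?f \<in> hom (tensor_group R B ?DN) (add_monoid N)"
    by (rule hom_compose[OF D_map_hom[OF cD c th] module_homs_tensor_hom[OF th]])
  have g: "?g \<in> hom (tensor_group R B ?DN) (add_monoid N)"
    by (rule hom_compose[OF hom_compose[OF tensor_assoc_hom[OF N] m] tensor_unit_hom[OF N]])
  have pt_closed: "?pt a b x \<in> carrier (tensor_group R B ?DN)"
    if "a \<in> carrier B" "b \<in> carrier B" "x \<in> carrier N" for a b x
    using pure_tensor_closed[OF cD that(1)] pure_tensor_closed[OF c that(2,3)] unfolding DN by blast
  have f_pure: "?f (?pt a b x) = \<theta> (pure_tensor R B N a (\<theta> (pure_tensor R B N b x)))"
    if "a \<in> carrier B" "b \<in> carrier B" "x \<in> carrier N" for a b x
    unfolding comp_apply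
    by (subst D_map_pure[OF cD c th that(1)])
      (simp_all only: DN pure_tensor_closed[OF c that(2,3)])
  have g_pure: "?g (?pt a b x) = \<phi> (pure_tensor R B B a b) \<odot>\<^bsub>N\<^esub> x"
    if "a \<in> carrier B" "b \<in> carrier B" "x \<in> carrier N" for a b x
    unfolding comp_apply tensor_assoc_pure[OF N that]
      m_pure[OF pure_tensor_closed[OF closed_ops_self that(1,2)] that(3)]
    by (rule tensor_unit_pure[OF N phi_closed[OF pure_tensor_closed[OF closed_ops_self that(1,2)]] that(3)])
  have "compatible R B \<phi> N \<theta> \<longleftrightarrow> (\<forall>t\<in>carrier (tensor_group R B ?DN). ?f t = ?g t)"
  proof -
    have DDN: "carrier (tensor R B ?DN) = carrier (tensor_group R B ?DN)" by (simp add: tensor_def)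
    show ?thesis
      unfolding compatible_def Let_def compose_def DDN
      by (auto simp: fun_eq_iff restrict_def)
  qed
  also have "\<dots> \<longleftrightarrow> ?P"
  proof
    assume "\<forall>t\<in>carrier (tensor_group R B ?DN). ?f t = ?g t"
    then have "?f (?pt a b x) = ?g (?pt a b x)"
      if "a \<in> carrier B" "b \<in> carrier B" "x \<in> carrier N" for a b x
      using pt_closed that by blast
    then show ?P by (simp only: f_pure g_pure) blast
  next
    assume P: ?P
    show "\<forall>t\<in>carrier (tensor_group R B ?DN). ?f t = ?g t"
      by (intro ballI, rule iterated_tensor_hom_eqI[OF c N.a_comm_group f g])
        (use P in \<open>simp only: f_pure g_pure\<close>)
  qed
  finally show ?thesis .
qed

lemma is_category_phi_category: "is_category (phi_category R B \<phi> ::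
    (('a, 'm) module \<times> (('b \<times> 'm \<Rightarrow>\<^sub>0 int) set \<Rightarrow> 'm), 'm \<Rightarrow> 'm) category)"
proof -
  let ?D = "phi_category R B \<phi> ::
    (('a, 'm) module \<times> (('b \<times> 'm \<Rightarrow>\<^sub>0 int) set \<Rightarrow> 'm), 'm \<Rightarrow> 'm) category"
  have ext: "f \<in> extensional (carrier M)" if "f \<in> module_homs R M N" for f M N
    using that by (auto simp: module_homs_def PiE_def)
  have funcset: "f \<in> carrier M \<rightarrow> carrier N" if "f \<in> module_homs R M N" for f M N
    using that by (auto simp: module_homs_def)
  have mem: "f x \<in> carrier N" if "f \<in> module_homs R M N" "x \<in> carrier M" for f M N x
    by (rule funcset_mem[OF funcset[OF that(1)] that(2)])
  have obj: "left_module R N" "\<theta> \<in> module_homs R (tensor R B N) N"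
    if "(N, \<theta>) \<in> cat_obj ?D" for N \<theta>
    using that by (auto simp: phi_category_def normal_module_def)
  have hom_iff: "f \<in> cat_hom ?D (N, \<theta>) (N', \<theta>') \<longleftrightarrow> f \<in> module_homs R N N' \<and>
      (\<forall>b\<in>carrier B. \<forall>x\<in>carrier N. f (\<theta> (pure_tensor R B N b x)) = \<theta>' (pure_tensor R B N' b (f x)))"
    if "(N, \<theta>) \<in> cat_obj ?D" "(N', \<theta>') \<in> cat_obj ?D" for f N \<theta> N' \<theta>'
    using pair_morphism_iff[OF obj(1)[OF that(1)] obj(1)[OF that(2)] obj(2)[OF that(1)] obj(2)[OF that(2)], of f]
    unfolding phi_category_def by auto
  have act: "\<theta> (pure_tensor R B N b x) \<in> carrier N"
    if "(N, \<theta>) \<in> cat_obj ?D" "b \<in> carrier B" "x \<in> carrier N" for N \<theta> b x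
    using mem[OF obj(2)[OF that(1)]] pure_tensor_closed[OF closed_ops_left_module[OF obj(1)[OF that(1)]] that(2,3)]
    by (simp add: tensor_def)
  have id: "cat_id ?D (N, \<theta>) = (\<lambda>x\<in>carrier N. x)" for N \<theta>
    by (simp add: phi_category_def)
  have comp: "cat_comp ?D (L, \<eta>) (N, \<theta>) (N', \<theta>') g f = compose (carrier L) g f"
    for L \<eta> N \<theta> N' \<theta>' g f
    by (simp add: phi_category_def)
  show ?thesis
    unfolding is_category_def split_paired_Ball_Sigma
  proof (intro conjI ballI; clarify?)
    fix N \<theta> assume o: "(N, \<theta>) \<in> cat_obj ?D"
    show "cat_id ?D (N, \<theta>) \<in> cat_hom ?D (N, \<theta>) (N, \<theta>)"
      unfolding hom_iff[OF o o] id
      by (simp add: module_homs_id[OF obj(1)[OF o]] act[OF o])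
  next
    fix L \<eta> M \<zeta> N \<theta> f g
    assume o: "(L, \<eta>) \<in> cat_obj ?D" "(M, \<zeta>) \<in> cat_obj ?D"
      "(N, \<theta>) \<in> cat_obj ?D"
      and f: "f \<in> cat_hom ?D (L, \<eta>) (M, \<zeta>)"
      and g: "g \<in> cat_hom ?D (M, \<zeta>) (N, \<theta>)"
    note f = f[unfolded hom_iff[OF o(1,2)]] and g = g[unfolded hom_iff[OF o(2,3)]]
    show "cat_comp ?D (L, \<eta>) (M, \<zeta>) (N, \<theta>) g f
        \<in> cat_hom ?D (L, \<eta>) (N, \<theta>)"
      unfolding hom_iff[OF o(1,3)] comp
    proof (intro conjI ballI)
      show "compose (carrier L) g f \<in> module_homs R L N"
        by (rule module_homs_compose[OF obj(1)[OF o(1)] conjunct1[OF f] conjunct1[OF g]])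
      fix b x assume b: "b \<in> carrier B" and x: "x \<in> carrier L"
      have "g (f (\<eta> (pure_tensor R B L b x))) = \<theta> (pure_tensor R B N b (g (f x)))"
        using bspec[OF bspec[OF conjunct2[OF f] b] x]
          bspec[OF bspec[OF conjunct2[OF g] b] mem[OF conjunct1[OF f] x]] by simp
      then show "compose (carrier L) g f (\<eta> (pure_tensor R B L b x)) =
          \<theta> (pure_tensor R B N b (compose (carrier L) g f x))"
        by (simp only: compose_eq[OF x] compose_eq[OF act[OF o(1) b x]])
    qed
  next
    fix M \<zeta> N \<theta> f
    assume o: "(M, \<zeta>) \<in> cat_obj ?D" "(N, \<theta>) \<in> cat_obj ?D"
      and f: "f \<in> cat_hom ?D (M, \<zeta>) (N, \<theta>)"
    note f = conjunct1[OF f[unfolded hom_iff[OF o]]]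
    show "cat_comp ?D (M, \<zeta>) (M, \<zeta>) (N, \<theta>) f (cat_id ?D (M, \<zeta>)) = f"
      "cat_comp ?D (M, \<zeta>) (N, \<theta>) (N, \<theta>) (cat_id ?D (N, \<theta>)) f = f"
      unfolding comp id
      by (rule compose_Id[OF funcset[OF f] ext[OF f]], rule Id_compose[OF funcset[OF f] ext[OF f]])
  next
    fix K \<kappa> L \<eta> M \<zeta> N \<theta> f g h
    assume o: "(K, \<kappa>) \<in> cat_obj ?D" "(L, \<eta>) \<in> cat_obj ?D"
      and f: "f \<in> cat_hom ?D (K, \<kappa>) (L, \<eta>)"
    have "f \<in> carrier K \<rightarrow> carrier L"
      by (rule funcset[OF conjunct1[OF f[unfolded hom_iff[OF o]]]])
    then show "cat_comp ?D (K, \<kappa>) (M, \<zeta>) (N, \<theta>) h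
        (cat_comp ?D (K, \<kappa>) (L, \<eta>) (M, \<zeta>) g f) =
      cat_comp ?D (K, \<kappa>) (L, \<eta>) (N, \<theta>)
        (cat_comp ?D (L, \<eta>) (M, \<zeta>) (N, \<theta>) h g) f"
      unfolding comp by (rule compose_assoc)
  qed
qed

end


section \<open>Modules over a graded ring\<close>

text \<open>The two components of an element of a graded ring. The descriptions denote unique elements
  because \<open>S\<close> and \<open>Sm\<close> meet in zero only; they are meaningless off the carrier.\<close>

definition even_part :: "('a, 'r) ring_scheme \<Rightarrow> 'a set \<Rightarrow> 'a set \<Rightarrow> 'a \<Rightarrow> 'a" where
  "even_part A S Sm a = (THE s. s \<in> S \<and> (\<exists>\<alpha>\<in>Sm. a = s \<oplus>\<^bsub>A\<^esub> \<alpha>))"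

definition odd_part :: "('a, 'r) ring_scheme \<Rightarrow> 'a set \<Rightarrow> 'a set \<Rightarrow> 'a \<Rightarrow> 'a" where
  "odd_part A S Sm a = (THE \<alpha>. \<alpha> \<in> Sm \<and> (\<exists>s\<in>S. a = s \<oplus>\<^bsub>A\<^esub> \<alpha>))"

text \<open>The scalar multiplication of the whole graded ring on an \<open>S\<close>-module \<open>N\<close> on which the odd
  elements act by \<open>act\<close>. It is restricted to the carriers, as \<^const>\<open>normal_module\<close> asks.\<close>

definition extend_scalars ::
  "('a, 'r) ring_scheme \<Rightarrow> 'a set \<Rightarrow> 'a set \<Rightarrow> ('a \<Rightarrow> 'm \<Rightarrow> 'm) \<Rightarrow> ('a, 'm) module \<Rightarrow> ('a, 'm) module" where
  "extend_scalars A S Sm act N = N\<lparr>smult := (\<lambda>a\<in>carrier A. \<lambda>x\<in>carrier N.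
     even_part A S Sm a \<odot>\<^bsub>N\<^esub> x \<oplus>\<^bsub>N\<^esub> act (odd_part A S Sm a) x)\<rparr>"

context z2_graded_ring
begin

text \<open>The even part \<open>E\<close> as a ring and the odd part \<open>B\<close> as a bimodule over it.\<close>

abbreviation E where "E \<equiv> even_ring A S"
abbreviation B where "B \<equiv> mult_bimodule A Sm"

lemma even_ring: "ring E"
  by (rule subring_is_ring[OF even_subring])

lemma even_closed:
  "\<zero> \<in> S" "\<one> \<in> S" "s \<in> S \<Longrightarrow> s \<in> carrier A" "s \<in> S \<Longrightarrow> \<ominus> s \<in> S"
  "\<lbrakk>s \<in> S; t \<in> S\<rbrakk> \<Longrightarrow> s \<oplus> t \<in> S" "\<lbrakk>s \<in> S; t \<in> S\<rbrakk> \<Longrightarrow> s \<otimes> t \<in> S"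
  using subringE[OF even_subring] by auto

lemma odd_closed:
  "\<zero> \<in> Sm" "\<alpha> \<in> Sm \<Longrightarrow> \<alpha> \<in> carrier A" "\<alpha> \<in> Sm \<Longrightarrow> \<ominus> \<alpha> \<in> Sm"
  "\<lbrakk>\<alpha> \<in> Sm; \<beta> \<in> Sm\<rbrakk> \<Longrightarrow> \<alpha> \<oplus> \<beta> \<in> Sm"
  using additive_subgroup.zero_closed[OF odd_subgroup] additive_subgroup.a_Hcarr[OF odd_subgroup]
    additive_subgroup.a_closed[OF odd_subgroup]
    subgroup.m_inv_closed[OF additive_subgroup.a_subgroup[OF odd_subgroup]]
  by (auto simp: a_inv_def)

lemma decompose:
  assumes "a \<in> carrier A"
  obtains s \<alpha> where "s \<in> S" "\<alpha> \<in> Sm" "a = s \<oplus> \<alpha>"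
  using assms unfolding decomposition[symmetric] set_add_def' by blast

lemma decomposition_unique:
  assumes "s \<in> S" "t \<in> S" "\<alpha> \<in> Sm" "\<beta> \<in> Sm" "s \<oplus> \<alpha> = t \<oplus> \<beta>"
  shows "s = t" and "\<alpha> = \<beta>"
proof -
  have c: "s \<in> carrier A" "t \<in> carrier A" "\<alpha> \<in> carrier A" "\<beta> \<in> carrier A"
    using assms even_closed odd_closed by auto
  have "\<ominus> t \<oplus> (s \<oplus> \<alpha>) \<oplus> \<ominus> \<alpha> = \<ominus> t \<oplus> (t \<oplus> \<beta>) \<oplus> \<ominus> \<alpha>" using assms(5) by simp
  then have eq: "\<ominus> t \<oplus> s = \<beta> \<oplus> \<ominus> \<alpha>"
    using c by (simp add: a_assoc r_neg r_neg1)
  have "\<ominus> t \<oplus> s \<in> S" using assms(1,2) by (simp add: even_closed)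
  moreover have "\<beta> \<oplus> \<ominus> \<alpha> \<in> Sm" using assms(3,4) by (simp add: odd_closed)
  ultimately have z: "\<ominus> t \<oplus> s = \<zero>" using independent eq by auto
  have "s = \<ominus> (\<ominus> t)" by (rule minus_equality[symmetric]) (use c z in \<open>simp_all add: a_comm\<close>)
  then show "s = t" using c by simp
  then show "\<alpha> = \<beta>" using c assms(5) by simp
qed

lemma even_part_add [simp]: "\<lbrakk>s \<in> S; \<alpha> \<in> Sm\<rbrakk> \<Longrightarrow> even_part A S Sm (s \<oplus> \<alpha>) = s"
  unfolding even_part_def using decomposition_unique(1) by (intro the_equality) blast+

lemma odd_part_add [simp]: "\<lbrakk>s \<in> S; \<alpha> \<in> Sm\<rbrakk> \<Longrightarrow> odd_part A S Sm (s \<oplus> \<alpha>) = \<alpha>"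
  unfolding odd_part_def using decomposition_unique(2) by (intro the_equality) blast+

lemma
  shows even_part_even: "s \<in> S \<Longrightarrow> even_part A S Sm s = s"
    and odd_part_even: "s \<in> S \<Longrightarrow> odd_part A S Sm s = \<zero>"
    and even_part_odd: "\<alpha> \<in> Sm \<Longrightarrow> even_part A S Sm \<alpha> = \<zero>"
    and odd_part_odd: "\<alpha> \<in> Sm \<Longrightarrow> odd_part A S Sm \<alpha> = \<alpha>"
  using even_part_add[of s \<zero>] odd_part_add[of s \<zero>] even_part_add[of \<zero> \<alpha>] odd_part_add[of \<zero> \<alpha>]
  by (simp_all add: even_closed odd_closed)

lemma odd_bimodule: "ring_bimodule E B"
  unfolding ring_bimodule_def ring_bimodule_axioms_def
  using even_ring
  by (simp add: mult_bimodule_def even_closed odd_closed even_odd odd_even l_distr r_distr m_assoc)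

lemma
  shows graded_phi_hom: "graded_phi A S Sm \<in> hom (tensor_group E B B) (add_monoid E)"
    and graded_phi_pure: "\<And>\<alpha> \<beta>. \<alpha> \<in> Sm \<Longrightarrow> \<beta> \<in> Sm \<Longrightarrow>
      graded_phi A S Sm (pure_tensor E B B \<alpha> \<beta>) = \<alpha> \<otimes> \<beta>"
proof -
  interpret R: ring E by (rule even_ring)
  note c = ring_bimodule.closed_ops_self[OF odd_bimodule]
  have b: "balanced E B B (add_monoid E) (\<lambda>\<alpha> \<beta>. \<alpha> \<otimes> \<beta>)"
    by (simp add: balanced_def mult_bimodule_def odd_odd l_distr r_distr m_assoc even_closed odd_closed)
  show "graded_phi A S Sm \<in> hom (tensor_group E B B) (add_monoid E)"
    unfolding graded_phi_def by (rule tensor_lift_hom[OF c R.a_comm_group b])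
  show "graded_phi A S Sm (pure_tensor E B B \<alpha> \<beta>) = \<alpha> \<otimes> \<beta>" if "\<alpha> \<in> Sm" "\<beta> \<in> Sm" for \<alpha> \<beta>
    unfolding graded_phi_def
    by (rule tensor_lift_pure[OF c R.a_comm_group b]) (simp_all add: mult_bimodule_def that)
qed

lemma graded_compatible_iff:
  assumes N: "left_module E N" and th: "\<theta> \<in> module_homs E (tensor E B N) N"
  shows "compatible E B (graded_phi A S Sm) N \<theta> \<longleftrightarrow>
    (\<forall>\<alpha>\<in>Sm. \<forall>\<beta>\<in>Sm. \<forall>x\<in>carrier N.
      \<theta> (pure_tensor E B N \<alpha> (\<theta> (pure_tensor E B N \<beta> x))) = (\<alpha> \<otimes> \<beta>) \<odot>\<^bsub>N\<^esub> x)"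
proof -
  have B: "carrier B = Sm" "rsmult B = mult A" by (simp_all add: mult_bimodule_def)
  have "graded_phi A S Sm (pure_tensor E B B \<alpha> (rsmult B \<beta> r)) =
      graded_phi A S Sm (pure_tensor E B B \<alpha> \<beta>) \<otimes>\<^bsub>E\<^esub> r"
    if "\<alpha> \<in> carrier B" "\<beta> \<in> carrier B" "r \<in> carrier E" for \<alpha> \<beta> r
    using that by (simp add: B graded_phi_pure odd_even m_assoc even_closed odd_closed)
  from ring_bimodule.compatible_iff[OF odd_bimodule N th graded_phi_hom this]
  show ?thesis by (simp add: B graded_phi_pure)
qed

text \<open>The odd action that a homomorphism \<open>\<theta> : D N \<rightarrow> N\<close> encodes is biadditive, linear and balanced.\<close>

lemma
  assumes N: "left_module E N" and th: "\<theta> \<in> module_homs E (tensor E B N) N"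
  defines "act \<equiv> \<lambda>\<alpha> x. \<theta> (pure_tensor E B N \<alpha> x)"
  shows odd_action_closed: "\<lbrakk>\<alpha> \<in> Sm; x \<in> carrier N\<rbrakk> \<Longrightarrow> act \<alpha> x \<in> carrier N"
    and odd_action_add_left: "\<lbrakk>\<alpha> \<in> Sm; \<beta> \<in> Sm; x \<in> carrier N\<rbrakk>
      \<Longrightarrow> act (\<alpha> \<oplus> \<beta>) x = act \<alpha> x \<oplus>\<^bsub>N\<^esub> act \<beta> x"
    and odd_action_add_right: "\<lbrakk>\<alpha> \<in> Sm; x \<in> carrier N; y \<in> carrier N\<rbrakk>
      \<Longrightarrow> act \<alpha> (x \<oplus>\<^bsub>N\<^esub> y) = act \<alpha> x \<oplus>\<^bsub>N\<^esub> act \<alpha> y"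
    and odd_action_even_left: "\<lbrakk>s \<in> S; \<alpha> \<in> Sm; x \<in> carrier N\<rbrakk>
      \<Longrightarrow> act (s \<otimes> \<alpha>) x = s \<odot>\<^bsub>N\<^esub> act \<alpha> x"
    and odd_action_even_right: "\<lbrakk>s \<in> S; \<alpha> \<in> Sm; x \<in> carrier N\<rbrakk>
      \<Longrightarrow> act (\<alpha> \<otimes> s) x = act \<alpha> (s \<odot>\<^bsub>N\<^esub> x)"
proof -
  have B: "carrier B = Sm" "rsmult B = mult A" "smult B = mult A" "add B = add A"
    by (simp_all add: mult_bimodule_def)
  note c = ring_bimodule.closed_ops_left_module[OF odd_bimodule N]
  note h = ring_bimodule.module_homs_tensor_hom[OF odd_bimodule th]
  have p: "pure_tensor E B N \<alpha> x \<in> carrier (tensor_group E B N)" if "\<alpha> \<in> Sm" "x \<in> carrier N" for \<alpha> x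
    by (rule pure_tensor_closed[OF c]) (simp_all add: B that)
  show "act \<alpha> x \<in> carrier N" if "\<alpha> \<in> Sm" "x \<in> carrier N"
    unfolding act_def using hom_in_carrier[OF h p[OF that]] by simp
  show "act (\<alpha> \<oplus> \<beta>) x = act \<alpha> x \<oplus>\<^bsub>N\<^esub> act \<beta> x" if "\<alpha> \<in> Sm" "\<beta> \<in> Sm" "x \<in> carrier N"
    unfolding act_def
    using hom_mult[OF h p[OF that(1,3)] p[OF that(2,3)]] pure_tensor_add_left[OF c, of \<alpha> \<beta> x] that
    by (simp add: B)
  show "act \<alpha> (x \<oplus>\<^bsub>N\<^esub> y) = act \<alpha> x \<oplus>\<^bsub>N\<^esub> act \<alpha> y" if "\<alpha> \<in> Sm" "x \<in> carrier N" "y \<in> carrier N"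
    unfolding act_def
    using hom_mult[OF h p[OF that(1,2)] p[OF that(1,3)]] pure_tensor_add_right[OF c, of \<alpha> x y] that
    by (simp add: B)
  show "act (s \<otimes> \<alpha>) x = s \<odot>\<^bsub>N\<^esub> act \<alpha> x" if "s \<in> S" "\<alpha> \<in> Sm" "x \<in> carrier N"
  proof -
    have "s \<odot>\<^bsub>tensor E B N\<^esub> pure_tensor E B N \<alpha> x = pure_tensor E B N (s \<otimes> \<alpha>) x"
      using ring_bimodule.tensor_smult_pure[OF odd_bimodule c, of s \<alpha> x] that by (simp add: B)
    moreover have "\<theta> (s \<odot>\<^bsub>tensor E B N\<^esub> pure_tensor E B N \<alpha> x) = s \<odot>\<^bsub>N\<^esub> \<theta> (pure_tensor E B N \<alpha> x)"
      using th p[OF that(2,3)] that(1) by (simp add: module_homs_def tensor_def)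
    ultimately show ?thesis unfolding act_def by simp
  qed
  show "act (\<alpha> \<otimes> s) x = act \<alpha> (s \<odot>\<^bsub>N\<^esub> x)" if "s \<in> S" "\<alpha> \<in> Sm" "x \<in> carrier N"
    unfolding act_def using pure_tensor_rsmult[OF c, of \<alpha> s x] that by (simp add: B)
qed

text \<open>Associativity is the one axiom that mixes the four products: in
  \<open>(s + \<alpha>) (t + \<beta>) = (s t + \<alpha> \<beta>) + (s \<beta> + \<alpha> t)\<close> they are covered by the associativity of \<open>N\<close>, by
  \<open>act_act\<close>, by \<open>even_left\<close> and by \<open>even_right\<close>, respectively.\<close>

lemma left_module_extend_scalars:
  assumes N: "left_module E N"
    and closed: "\<And>\<alpha> x. \<lbrakk>\<alpha> \<in> Sm; x \<in> carrier N\<rbrakk> \<Longrightarrow> act \<alpha> x \<in> carrier N"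
    and add_left: "\<And>\<alpha> \<beta> x. \<lbrakk>\<alpha> \<in> Sm; \<beta> \<in> Sm; x \<in> carrier N\<rbrakk>
      \<Longrightarrow> act (\<alpha> \<oplus> \<beta>) x = act \<alpha> x \<oplus>\<^bsub>N\<^esub> act \<beta> x"
    and add_right: "\<And>\<alpha> x y. \<lbrakk>\<alpha> \<in> Sm; x \<in> carrier N; y \<in> carrier N\<rbrakk>
      \<Longrightarrow> act \<alpha> (x \<oplus>\<^bsub>N\<^esub> y) = act \<alpha> x \<oplus>\<^bsub>N\<^esub> act \<alpha> y"
    and even_left: "\<And>s \<alpha> x. \<lbrakk>s \<in> S; \<alpha> \<in> Sm; x \<in> carrier N\<rbrakk> \<Longrightarrow> act (s \<otimes> \<alpha>) x = s \<odot>\<^bsub>N\<^esub> act \<alpha> x"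
    and even_right: "\<And>s \<alpha> x. \<lbrakk>s \<in> S; \<alpha> \<in> Sm; x \<in> carrier N\<rbrakk> \<Longrightarrow> act (\<alpha> \<otimes> s) x = act \<alpha> (s \<odot>\<^bsub>N\<^esub> x)"
    and act_act: "\<And>\<alpha> \<beta> x. \<lbrakk>\<alpha> \<in> Sm; \<beta> \<in> Sm; x \<in> carrier N\<rbrakk>
      \<Longrightarrow> act \<alpha> (act \<beta> x) = (\<alpha> \<otimes> \<beta>) \<odot>\<^bsub>N\<^esub> x"
  shows "left_module A (extend_scalars A S Sm act N)"
proof -
  interpret N: left_module E N by (rule N)
  let ?M = "extend_scalars A S Sm act N"
  have M: "carrier ?M = carrier N" "add ?M = add N" "zero ?M = zero N"
    by (simp_all add: extend_scalars_def)
  have sm: "s \<odot>\<^bsub>N\<^esub> x \<in> carrier N" if "s \<in> S" "x \<in> carrier N" for s x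
    using N.smult_closed that by simp
  have smult: "(s \<oplus> \<alpha>) \<odot>\<^bsub>?M\<^esub> x = s \<odot>\<^bsub>N\<^esub> x \<oplus>\<^bsub>N\<^esub> act \<alpha> x"
    if "s \<in> S" "\<alpha> \<in> Sm" "x \<in> carrier N" for s \<alpha> x
    using that by (simp add: extend_scalars_def even_closed odd_closed)
  have l_distr_N: "(s \<oplus> t) \<odot>\<^bsub>N\<^esub> x = s \<odot>\<^bsub>N\<^esub> x \<oplus>\<^bsub>N\<^esub> t \<odot>\<^bsub>N\<^esub> x"
    and assoc_N: "(s \<otimes> t) \<odot>\<^bsub>N\<^esub> x = s \<odot>\<^bsub>N\<^esub> (t \<odot>\<^bsub>N\<^esub> x)"
    if "s \<in> S" "t \<in> S" "x \<in> carrier N" for s t x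
    using N.smult_l_distr[of s t x] N.smult_assoc[of s t x] that by simp_all
  have r_distr_N: "s \<odot>\<^bsub>N\<^esub> (x \<oplus>\<^bsub>N\<^esub> y) = s \<odot>\<^bsub>N\<^esub> x \<oplus>\<^bsub>N\<^esub> s \<odot>\<^bsub>N\<^esub> y"
    if "s \<in> S" "x \<in> carrier N" "y \<in> carrier N" for s x y
    using N.smult_r_distr[of s x y] that by simp
  \<comment> \<open>Cancel in \<open>act 0 x = act (0 + 0) x = act 0 x + act 0 x\<close>.\<close>
  have zero: "act \<zero> x = \<zero>\<^bsub>N\<^esub>" if x: "x \<in> carrier N" for x
    using add_left[of \<zero> \<zero> x] closed[of \<zero> x] x odd_closed(1) by (simp add: N.add.l_cancel_one')
  have "abelian_group ?M"
  proof (rule abelian_groupI)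
    fix x assume "x \<in> carrier ?M"
    then show "\<exists>y\<in>carrier ?M. y \<oplus>\<^bsub>?M\<^esub> x = \<zero>\<^bsub>?M\<^esub>"
      unfolding M by (intro bexI[of _ "\<ominus>\<^bsub>N\<^esub> x"]) (simp_all add: N.l_neg)
  qed (simp_all add: M N.a_ac)
  moreover have "left_module_axioms A ?M"
  proof
    fix a x assume a: "a \<in> carrier A" and x: "x \<in> carrier ?M"
    obtain s \<alpha> where s: "s \<in> S" "\<alpha> \<in> Sm" "a = s \<oplus> \<alpha>" using a by (rule decompose)
    show "a \<odot>\<^bsub>?M\<^esub> x \<in> carrier ?M"
      using s x by (simp add: M smult sm closed)
  next
    fix a b x assume ab: "a \<in> carrier A" "b \<in> carrier A" and x: "x \<in> carrier ?M"
    obtain s \<alpha> where s: "s \<in> S" "\<alpha> \<in> Sm" "a = s \<oplus> \<alpha>" using ab(1) by (rule decompose)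
    obtain t \<beta> where t: "t \<in> S" "\<beta> \<in> Sm" "b = t \<oplus> \<beta>" using ab(2) by (rule decompose)
    note xN = x[unfolded M]
    have "a \<oplus> b = (s \<oplus> t) \<oplus> (\<alpha> \<oplus> \<beta>)"
      using s t by (simp add: a_ac even_closed odd_closed)
    then have "(a \<oplus> b) \<odot>\<^bsub>?M\<^esub> x = (s \<oplus> t) \<odot>\<^bsub>N\<^esub> x \<oplus>\<^bsub>N\<^esub> act (\<alpha> \<oplus> \<beta>) x"
      using s t xN by (simp only: smult even_closed odd_closed)
    then show "(a \<oplus> b) \<odot>\<^bsub>?M\<^esub> x = a \<odot>\<^bsub>?M\<^esub> x \<oplus>\<^bsub>?M\<^esub> b \<odot>\<^bsub>?M\<^esub> x"
      using s t xN by (simp add: M smult l_distr_N add_left sm closed N.a_ac)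
    have "a \<otimes> b = (s \<otimes> t \<oplus> \<alpha> \<otimes> \<beta>) \<oplus> (s \<otimes> \<beta> \<oplus> \<alpha> \<otimes> t)"
      using s t by (simp add: l_distr r_distr a_ac even_closed odd_closed)
    then have "(a \<otimes> b) \<odot>\<^bsub>?M\<^esub> x =
        (s \<otimes> t \<oplus> \<alpha> \<otimes> \<beta>) \<odot>\<^bsub>N\<^esub> x \<oplus>\<^bsub>N\<^esub> act (s \<otimes> \<beta> \<oplus> \<alpha> \<otimes> t) x"
      using s t xN by (simp only: smult even_closed odd_closed odd_odd even_odd odd_even)
    also have "\<dots> = s \<odot>\<^bsub>N\<^esub> (t \<odot>\<^bsub>N\<^esub> x) \<oplus>\<^bsub>N\<^esub> act \<alpha> (act \<beta> x) \<oplus>\<^bsub>N\<^esub>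
        (s \<odot>\<^bsub>N\<^esub> act \<beta> x \<oplus>\<^bsub>N\<^esub> act \<alpha> (t \<odot>\<^bsub>N\<^esub> x))"
      using s t xN
      by (simp add: l_distr_N assoc_N add_left even_left even_right act_act even_closed odd_odd
          even_odd odd_even)
    also have "\<dots> = s \<odot>\<^bsub>N\<^esub> (t \<odot>\<^bsub>N\<^esub> x \<oplus>\<^bsub>N\<^esub> act \<beta> x) \<oplus>\<^bsub>N\<^esub> act \<alpha> (t \<odot>\<^bsub>N\<^esub> x \<oplus>\<^bsub>N\<^esub> act \<beta> x)"
      using s t xN by (simp add: r_distr_N add_right sm closed N.a_ac)
    also have "\<dots> = a \<odot>\<^bsub>?M\<^esub> (b \<odot>\<^bsub>?M\<^esub> x)"
      using s t xN by (simp add: smult sm closed)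
    finally show "(a \<otimes> b) \<odot>\<^bsub>?M\<^esub> x = a \<odot>\<^bsub>?M\<^esub> (b \<odot>\<^bsub>?M\<^esub> x)" .
  next
    fix a x y assume a: "a \<in> carrier A" and x: "x \<in> carrier ?M" "y \<in> carrier ?M"
    obtain s \<alpha> where s: "s \<in> S" "\<alpha> \<in> Sm" "a = s \<oplus> \<alpha>" using a by (rule decompose)
    show "a \<odot>\<^bsub>?M\<^esub> (x \<oplus>\<^bsub>?M\<^esub> y) = a \<odot>\<^bsub>?M\<^esub> x \<oplus>\<^bsub>?M\<^esub> a \<odot>\<^bsub>?M\<^esub> y"
      using s x by (simp add: M smult r_distr_N add_right sm closed N.a_ac)
  next
    fix x assume x: "x \<in> carrier ?M"
    then show "\<one> \<odot>\<^bsub>?M\<^esub> x = x"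
      using smult[of \<one> \<zero> x] N.smult_one[of x] zero[of x]
      by (simp add: M even_closed odd_closed)
  qed
  ultimately show ?thesis
    using ring_axioms unfolding left_module_def by blast
qed

lemma left_module_restrict_scalars:
  assumes "left_module A M"
  shows "left_module E (restrict_scalars S M)"
proof -
  interpret M: left_module A M by (rule assms)
  have "abelian_group (restrict_scalars S M)"
  proof (rule abelian_groupI)
    fix x assume "x \<in> carrier (restrict_scalars S M)"
    then show "\<exists>y\<in>carrier (restrict_scalars S M).
        y \<oplus>\<^bsub>restrict_scalars S M\<^esub> x = \<zero>\<^bsub>restrict_scalars S M\<^esub>"
      by (intro bexI[of _ "\<ominus>\<^bsub>M\<^esub> x"]) (simp_all add: restrict_scalars_def M.M.l_neg)
  qed (simp_all add: restrict_scalars_def M.M.a_ac)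
  moreover have "left_module_axioms E (restrict_scalars S M)"
    by unfold_locales
      (simp_all add: restrict_scalars_def even_closed M.smult_closed M.smult_l_distr M.smult_r_distr
        M.smult_assoc M.smult_one)
  ultimately show ?thesis
    using even_ring unfolding left_module_def by blast
qed

lemma
  assumes M: "left_module A M"
  shows action_map_module_homs: "action_map A S Sm M \<in>
      module_homs E (tensor E B (restrict_scalars S M)) (restrict_scalars S M)"
    and action_map_pure: "\<And>\<alpha> x. \<alpha> \<in> Sm \<Longrightarrow> x \<in> carrier M \<Longrightarrow>
      action_map A S Sm M (pure_tensor E B (restrict_scalars S M) \<alpha> x) = \<alpha> \<odot>\<^bsub>M\<^esub> x"
proof -
  interpret M: left_module A M by (rule M)
  let ?N = "restrict_scalars S M"
  have rs: "carrier ?N = carrier M" "add ?N = add M" "zero ?N = zero M"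
    "\<And>s. s \<in> S \<Longrightarrow> smult ?N s = smult M s"
    by (simp_all add: restrict_scalars_def)
  have B: "carrier B = Sm" "rsmult B = mult A" "smult B = mult A" "add B = add A"
    by (simp_all add: mult_bimodule_def)
  note N = left_module_restrict_scalars[OF M]
  note c = ring_bimodule.closed_ops_left_module[OF odd_bimodule N]
  have b: "balanced E B ?N (add_monoid M) (\<lambda>\<alpha> x. \<alpha> \<odot>\<^bsub>M\<^esub> x)"
    by (simp add: balanced_def rs B even_closed odd_closed M.smult_closed M.smult_l_distr
        M.smult_r_distr M.smult_assoc)
  show pure: "action_map A S Sm M (pure_tensor E B ?N \<alpha> x) = \<alpha> \<odot>\<^bsub>M\<^esub> x"
    if "\<alpha> \<in> Sm" "x \<in> carrier M" for \<alpha> x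
    unfolding action_map_def
    by (rule tensor_lift_pure[OF c M.M.a_comm_group b]) (simp_all add: rs B that)
  show "action_map A S Sm M \<in> module_homs E (tensor E B ?N) ?N"
  proof (rule ring_bimodule.module_homs_tensorI[OF odd_bimodule c N])
    show "action_map A S Sm M \<in> hom (tensor_group E B ?N) (add_monoid ?N)"
      unfolding action_map_def rs by (rule tensor_lift_hom[OF c M.M.a_comm_group b])
    show "action_map A S Sm M \<in> extensional (carrier (tensor_group E B ?N))"
      unfolding action_map_def by (rule tensor_lift_extensional[OF c M.M.a_comm_group b])
  qed (simp add: rs B pure even_odd M.smult_assoc even_closed odd_closed)
qed

lemma action_map_compatible:
  assumes M: "left_module A M"
  shows "compatible E B (graded_phi A S Sm) (restrict_scalars S M) (action_map A S Sm M)"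
proof -
  interpret M: left_module A M by (rule M)
  have "carrier (restrict_scalars S M) = carrier M" "\<And>s. s \<in> S \<Longrightarrow> smult (restrict_scalars S M) s = smult M s"
    by (simp_all add: restrict_scalars_def)
  then show ?thesis
    unfolding graded_compatible_iff[OF left_module_restrict_scalars[OF M] action_map_module_homs[OF M]]
    by (simp add: action_map_pure[OF M] M.smult_closed M.smult_assoc odd_closed odd_odd)
qed

lemma normal_module_restrict_scalars:
  assumes "normal_module A M"
  shows "normal_module E (restrict_scalars S M)"
proof -
  have "left_module E (restrict_scalars S M)"
    using assms by (intro left_module_restrict_scalars) (simp add: normal_module_def)
  then show ?thesis
    using assms by (simp add: normal_module_def restrict_scalars_def even_closed(3))
qed

lemma normal_module_extend_scalars:
  assumes "normal_module E N" "left_module A (extend_scalars A S Sm act N)"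
  shows "normal_module A (extend_scalars A S Sm act N)"
  using assms by (simp add: normal_module_def extend_scalars_def)

text \<open>The next two lemmas compare whole records; outside the carriers both sides are undefined.\<close>

lemma restrict_extend_scalars:
  assumes N: "normal_module E N" and zero: "\<And>x. x \<in> carrier N \<Longrightarrow> act \<zero> x = \<zero>\<^bsub>N\<^esub>"
  shows "restrict_scalars S (extend_scalars A S Sm act N) = N"
proof -
  interpret N: left_module E N using N by (simp add: normal_module_def)
  have "restrict (smult (extend_scalars A S Sm act N)) S s x = smult N s x" for s x
  proof (cases "s \<in> S")
    case s: True
    show ?thesis
    proof (cases "x \<in> carrier N")
      case True
      then show ?thesis
        using s N.smult_closed[of s x]
        by (simp add: extend_scalars_def even_closed even_part_even odd_part_even zero)
    next
      case False
      have "smult N s \<in> extensional (carrier N)" using N s by (simp add: normal_module_def)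
      then show ?thesis
        using s False extensional_arb[of "smult N s", OF _ False]
        by (simp add: extend_scalars_def even_closed)
    qed
  next
    case False
    have "smult N \<in> extensional S" using N by (simp add: normal_module_def)
    from extensional_arb[OF this False] show ?thesis using False by simp
  qed
  then have eq: "restrict (smult (extend_scalars A S Sm act N)) S = smult N" by (intro ext)
  have "restrict_scalars S (extend_scalars A S Sm act N) = (extend_scalars A S Sm act N)\<lparr>smult := smult N\<rparr>"
    unfolding restrict_scalars_def eq ..
  also have "\<dots> = N" by (simp add: extend_scalars_def)
  finally show ?thesis .
qed

lemma extend_restrict_scalars:
  assumes M: "normal_module A M"
    and act: "\<And>\<alpha> x. \<lbrakk>\<alpha> \<in> Sm; x \<in> carrier M\<rbrakk> \<Longrightarrow> act \<alpha> x = \<alpha> \<odot>\<^bsub>M\<^esub> x"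
  shows "extend_scalars A S Sm act (restrict_scalars S M) = M"
proof -
  interpret M: left_module A M using M by (simp add: normal_module_def)
  have "smult (extend_scalars A S Sm act (restrict_scalars S M)) a x = smult M a x" for a x
  proof (cases "a \<in> carrier A")
    case a: True
    show ?thesis
    proof (cases "x \<in> carrier M")
      case True
      obtain s \<alpha> where s: "s \<in> S" "\<alpha> \<in> Sm" "a = s \<oplus> \<alpha>" using a by (rule decompose)
      then show ?thesis
        using True a
        by (simp add: extend_scalars_def restrict_scalars_def act M.smult_l_distr even_closed odd_closed)
    next
      case False
      have "smult M a \<in> extensional (carrier M)" using M a by (simp add: normal_module_def)
      then show ?thesis
        using a False extensional_arb[of "smult M a", OF _ False]
        by (simp add: extend_scalars_def restrict_scalars_def)
    qed
  next
    case False
    have "smult M \<in> extensional (carrier A)" using M by (simp add: normal_module_def)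
    from extensional_arb[OF this False] show ?thesis using False by (simp add: extend_scalars_def)
  qed
  then have eq: "smult (extend_scalars A S Sm act (restrict_scalars S M)) = smult M" by (intro ext)
  have "extend_scalars A S Sm act (restrict_scalars S M) =
      M\<lparr>smult := smult (extend_scalars A S Sm act (restrict_scalars S M))\<rparr>"
    by (simp add: extend_scalars_def restrict_scalars_def)
  also have "\<dots> = M" unfolding eq by simp
  finally show ?thesis .
qed

lemma module_homs_iff_even_odd:
  assumes M: "left_module A M" and M': "left_module A M'"
  shows "f \<in> module_homs A M M' \<longleftrightarrow> f \<in> module_homs E (restrict_scalars S M) (restrict_scalars S M') \<and>
    (\<forall>\<alpha>\<in>Sm. \<forall>x\<in>carrier M. f (\<alpha> \<odot>\<^bsub>M\<^esub> x) = \<alpha> \<odot>\<^bsub>M'\<^esub> f x)"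
proof -
  interpret M: left_module A M by (rule M)
  interpret M': left_module A M' by (rule M')
  let ?P = "f \<in> module_homs E (restrict_scalars S M) (restrict_scalars S M') \<and>
    (\<forall>\<alpha>\<in>Sm. \<forall>x\<in>carrier M. f (\<alpha> \<odot>\<^bsub>M\<^esub> x) = \<alpha> \<odot>\<^bsub>M'\<^esub> f x)"
  show ?thesis
  proof
    assume "f \<in> module_homs A M M'"
    then show ?P
      unfolding module_homs_def by (auto simp: restrict_scalars_def even_closed odd_closed)
  next
    assume P: ?P
    then have ext: "f \<in> carrier M \<rightarrow>\<^sub>E carrier M'"
      and add: "\<And>x y. \<lbrakk>x \<in> carrier M; y \<in> carrier M\<rbrakk> \<Longrightarrow> f (x \<oplus>\<^bsub>M\<^esub> y) = f x \<oplus>\<^bsub>M'\<^esub> f y"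
      and even: "\<And>s x. \<lbrakk>s \<in> S; x \<in> carrier M\<rbrakk> \<Longrightarrow> f (s \<odot>\<^bsub>M\<^esub> x) = s \<odot>\<^bsub>M'\<^esub> f x"
      by (simp_all add: module_homs_def restrict_scalars_def)
    have "f (a \<odot>\<^bsub>M\<^esub> x) = a \<odot>\<^bsub>M'\<^esub> f x" if a: "a \<in> carrier A" and x: "x \<in> carrier M" for a x
    proof -
      obtain s \<alpha> where "s \<in> S" "\<alpha> \<in> Sm" "a = s \<oplus> \<alpha>" using a by (rule decompose)
      then show ?thesis
        using PiE_mem[OF ext x] x P
        by (simp add: M.smult_l_distr M'.smult_l_distr add even even_closed odd_closed M.smult_closed)
    qed
    then show "f \<in> module_homs A M M'"
      using ext add by (simp add: module_homs_def)
  qed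
qed

end

theorem theorem3p4:
  fixes AS :: "('a, 'r) ring_scheme" and S Sm :: "'a set"
  assumes "z2_graded_ring AS S Sm"
  shows "category_isomorphism
    (module_category AS :: (('a, 'm) module, 'm \<Rightarrow> 'm) category)
    (phi_category (even_ring AS S) (mult_bimodule AS Sm) (graded_phi AS S Sm))
    (\<lambda>M. (restrict_scalars S M, action_map AS S Sm M))
    (\<lambda>M M' f. f)"
proof -
  interpret z2_graded_ring AS S Sm by (rule assms)
  let ?C = "module_category AS :: (('a, 'm) module, 'm \<Rightarrow> 'm) category"
  let ?D = "phi_category E B (graded_phi AS S Sm) ::
    (('a, 'm) module \<times> (('a \<times> 'm \<Rightarrow>\<^sub>0 int) set \<Rightarrow> 'm), 'm \<Rightarrow> 'm) category"
  define F where "F = (\<lambda>M :: ('a, 'm) module. (restrict_scalars S M, action_map AS S Sm M))"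
  define G where "G = (\<lambda>(N :: ('a, 'm) module, \<theta>).
    extend_scalars AS S Sm (\<lambda>\<alpha> x. \<theta> (pure_tensor E B N \<alpha> x)) N)"
  have B: "carrier B = Sm" by (simp add: mult_bimodule_def)
  have C: "normal_module AS M \<and> left_module AS M" if "M \<in> cat_obj ?C" for M
    using that by (simp add: module_category_def normal_module_def)
  have F_obj: "F M \<in> cat_obj ?D" if "M \<in> cat_obj ?C" for M
    using C[OF that] normal_module_restrict_scalars action_map_module_homs action_map_compatible
    by (auto simp: F_def phi_category_def)
  have GF: "G (F M) = M" if "M \<in> cat_obj ?C" for M
    unfolding G_def F_def prod.case
    using C[OF that] by (intro extend_restrict_scalars) (simp_all add: action_map_pure)
  have G_obj: "G X \<in> cat_obj ?C" and FG: "F (G X) = X" if X: "X \<in> cat_obj ?D" for X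
  proof -
    obtain N \<theta> where XN: "X = (N, \<theta>)" by (cases X)
    have Nn: "normal_module E N" and N: "left_module E N" and th: "\<theta> \<in> module_homs E (tensor E B N) N"
      and comp: "compatible E B (graded_phi AS S Sm) N \<theta>"
      using X by (auto simp: XN phi_category_def normal_module_def)
    let ?act = "\<lambda>\<alpha> x. \<theta> (pure_tensor E B N \<alpha> x)"
    let ?M = "extend_scalars AS S Sm ?act N"
    note act = odd_action_closed[OF N th] odd_action_add_left[OF N th] odd_action_add_right[OF N th]
      odd_action_even_left[OF N th] odd_action_even_right[OF N th]
    interpret N: left_module E N by (rule N)
    have M: "left_module AS ?M"
      by (rule left_module_extend_scalars[where act = ?act, OF N act])
        (use comp[unfolded graded_compatible_iff[OF N th]] in blast)+
    show "G X \<in> cat_obj ?C"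
      using normal_module_extend_scalars[OF Nn M] by (simp add: XN G_def module_category_def)
    have zero: "?act \<zero>\<^bsub>AS\<^esub> x = \<zero>\<^bsub>N\<^esub>" if x: "x \<in> carrier N" for x
      using act(2)[of "\<zero>\<^bsub>AS\<^esub>" "\<zero>\<^bsub>AS\<^esub>" x] act(1)[of "\<zero>\<^bsub>AS\<^esub>" x] x odd_closed(1)
      by (simp add: N.add.l_cancel_one')
    have RM: "restrict_scalars S ?M = N"
      by (rule restrict_extend_scalars[where act = ?act, OF Nn zero])
    have "action_map AS S Sm ?M = \<theta>"
    proof -
      note c = ring_bimodule.closed_ops_left_module[OF odd_bimodule N]
      note aM = action_map_module_homs[OF M, unfolded RM]
      have "action_map AS S Sm ?M t = \<theta> t" if t: "t \<in> carrier (tensor_group E B N)" for t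
      proof (rule tensor_hom_eqI[OF c N.a_comm_group
            ring_bimodule.module_homs_tensor_hom[OF odd_bimodule aM]
            ring_bimodule.module_homs_tensor_hom[OF odd_bimodule th] _ t])
        fix \<alpha> x assume "\<alpha> \<in> carrier B" and x: "x \<in> carrier N"
        then have \<alpha>: "\<alpha> \<in> Sm" by (simp add: B)
        have "action_map AS S Sm ?M (pure_tensor E B N \<alpha> x) = \<alpha> \<odot>\<^bsub>?M\<^esub> x"
          using action_map_pure[OF M \<alpha>, of x, unfolded RM] x by (simp add: extend_scalars_def)
        also have "\<dots> = \<zero>\<^bsub>AS\<^esub> \<odot>\<^bsub>N\<^esub> x \<oplus>\<^bsub>N\<^esub> ?act \<alpha> x"
          using \<alpha> x by (simp add: extend_scalars_def even_part_odd odd_part_odd odd_closed)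
        also have "\<dots> = ?act \<alpha> x"
          using N.smult_l_distr[of "\<zero>\<^bsub>AS\<^esub>" "\<zero>\<^bsub>AS\<^esub>" x] N.smult_closed[of "\<zero>\<^bsub>AS\<^esub>" x]
            act(1)[OF \<alpha> x] x even_closed(1)
          by (simp add: N.add.l_cancel_one')
        finally show "action_map AS S Sm ?M (pure_tensor E B N \<alpha> x) = ?act \<alpha> x" .
      qed
      then show ?thesis
        using aM th by (intro extensionalityI[where A = "carrier (tensor_group E B N)"])
          (auto simp: module_homs_def tensor_def PiE_def)
    qed
    then show "F (G X) = X" using RM by (simp add: XN F_def G_def)
  qed
  \<comment> \<open>Both functors fix the underlying functions, so functoriality of the inverse follows from
    this equality of hom-sets and \<open>F (G X) = X\<close>.\<close>
  have hom_iff: "f \<in> cat_hom ?D (F M) (F M') \<longleftrightarrow> f \<in> cat_hom ?C M M'"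
    if M: "M \<in> cat_obj ?C" and M': "M' \<in> cat_obj ?C" for f M M'
  proof -
    note lM = conjunct2[OF C[OF M]] and lM' = conjunct2[OF C[OF M']]
    have mem: "f x \<in> carrier M'"
      if "f \<in> module_homs E (restrict_scalars S M) (restrict_scalars S M')" "x \<in> carrier M" for x
      using that by (auto simp: module_homs_def restrict_scalars_def)
    have rs: "carrier (restrict_scalars S M) = carrier M" by (simp add: restrict_scalars_def)
    have "f \<in> cat_hom ?D (F M) (F M') \<longleftrightarrow>
        f \<in> module_homs E (restrict_scalars S M) (restrict_scalars S M') \<and>
        (\<forall>\<alpha>\<in>Sm. \<forall>x\<in>carrier M. f (action_map AS S Sm M (pure_tensor E B (restrict_scalars S M) \<alpha> x)) =
          action_map AS S Sm M' (pure_tensor E B (restrict_scalars S M') \<alpha> (f x)))"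
      using ring_bimodule.pair_morphism_iff[OF odd_bimodule
          left_module_restrict_scalars[OF lM] left_module_restrict_scalars[OF lM']
          action_map_module_homs[OF lM] action_map_module_homs[OF lM'], of f]
      unfolding F_def phi_category_def rs B by auto
    also have "\<dots> \<longleftrightarrow> f \<in> module_homs E (restrict_scalars S M) (restrict_scalars S M') \<and>
        (\<forall>\<alpha>\<in>Sm. \<forall>x\<in>carrier M. f (\<alpha> \<odot>\<^bsub>M\<^esub> x) = \<alpha> \<odot>\<^bsub>M'\<^esub> f x)"
      by (intro conj_cong ball_cong refl)
        (simp add: action_map_pure[OF lM] action_map_pure[OF lM'] mem)
    also have "\<dots> \<longleftrightarrow> f \<in> cat_hom ?C M M'"
      unfolding module_homs_iff_even_odd[OF lM lM', symmetric] by (simp add: module_category_def)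
    finally show ?thesis .
  qed
  have F_id: "cat_id ?D (F M) = cat_id ?C M" for M
    by (simp add: F_def phi_category_def module_category_def restrict_scalars_def)
  have F_comp: "cat_comp ?D (F L) (F M) (F N) g f = cat_comp ?C L M N g f" for L M N g f
    by (simp add: F_def phi_category_def module_category_def restrict_scalars_def)
  have catC: "is_category ?C" by (rule is_category_module_category)
  have catD: "is_category ?D" by (rule ring_bimodule.is_category_phi_category[OF odd_bimodule])
  have "is_functor ?C ?D F (\<lambda>M M' f. f)"
    unfolding is_functor_def by (simp add: F_obj hom_iff F_id F_comp)
  moreover have "is_functor ?D ?C G (\<lambda>X Y f. f)"
  proof -
    have "f \<in> cat_hom ?C (G X) (G Y) \<longleftrightarrow> f \<in> cat_hom ?D X Y"
      if "X \<in> cat_obj ?D" "Y \<in> cat_obj ?D" for X Y f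
      using hom_iff[OF G_obj[OF that(1)] G_obj[OF that(2)], of f]
      by (simp only: FG[OF that(1)] FG[OF that(2)])
    moreover have "cat_id ?C (G X) = cat_id ?D X" if "X \<in> cat_obj ?D" for X
      using F_id[of "G X"] by (simp only: FG[OF that])
    moreover have "cat_comp ?C (G X) (G Y) (G Z) g f = cat_comp ?D X Y Z g f"
      if "X \<in> cat_obj ?D" "Y \<in> cat_obj ?D" "Z \<in> cat_obj ?D" for X Y Z g f
      using F_comp[of "G X" "G Y" "G Z" g f]
      by (simp only: FG[OF that(1)] FG[OF that(2)] FG[OF that(3)])
    ultimately show ?thesis unfolding is_functor_def by (simp add: G_obj)
  qed
  ultimately have "category_isomorphism ?C ?D F (\<lambda>M M' f. f)"
    unfolding category_isomorphism_def using catC catD GF FG by blast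
  then show ?thesis unfolding F_def .
qed

end
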